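(* Let $(\mathcal{W},w)=\{(W_i,w_i)\}_{i\in I}$ be a fusion frame for $\mathcal{H}$. Let $v=\{v_i\}_{i\in I}$ be a family of weights and suppose that there is $\delta>0$ with $v_i>\delta$ for each $i\in I$. Then the component preserving dual fusion frames of $(\mathcal{W},w)$ with weights $v$ are exactly the Bessel fusion sequences $(\mathcal{V},v)=\{(V_i,v_i)\}_{i\in I}$ for which there is $R\in L(\mathcal{K}_{\mathcal{W}},\mathcal{H})$ such that, for every $i\in I$, $$V_i=\left[S_{\mathcal{W},w}^{-1}T_{\mathcal{W},w}+R\left(I_{\mathcal{K}_{\mathcal{W}}}-T_{\mathcal{W},w}^{*}S_{\mathcal{W},w}^{-1}T_{\mathcal{W},w}\right)\right]\left(p_i\mathcal{K}_{\mathcal{W}}\right).$$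
   Context: $\mathcal{H}$ is a separable Hilbert space and $I$ is a countable index set. $L(\mathcal{X},\mathcal{Y})$ denotes the bounded linear operators from $\mathcal{X}$ to $\mathcal{Y}$, and $\pi_V$ the orthogonal projection onto a closed subspace $V$. Let $\mathcal{W}=\{W_i\}_{i\in I}$ be a family of closed subspaces of $\mathcal{H}$ and $w=\{w_i\}_{i\in I}$ a family of weights, i.e. $w_i>0$ for all $i$; all families of weights are assumed to be in $\ell^\infty(I)$. Write $(\mathcal{W},w)=\{(W_i,w_i)\}_{i\in I}$. $(\mathcal{W},w)$ is a fusion frame for $\mathcal{H}$ if there are constants $0<\alpha\le\beta<\infty$ with $\alpha\|f\|^2\le\sum_{i\in I}w_i^2\|\pi_{W_i}(f)\|^2\le\beta\|f\|^2$ for all $f\in\mathcal{H}$; it is a Bessel fusion sequence if the upper bound holds, but not necessarily the lower one (in both cases the $W_i$ are closed subspaces). $\mathcal{K}_{\mathcal{W}}:=\bigoplus_{i\in I}W_i=\{\{f_i\}_{i\in I}: f_i\in W_i,\ \{\|f_i\|\}_{i\in I}\in\ell^2(I)\}$ is a Hilbert space with inner product $\langle\{f_i\},\{g_i\}\rangle=\sum_{i\in I}\langle f_i,g_i\rangle$. For a Bessel fusion sequence $(\mathcal{W},w)$, the synthesis operator is the bounded operator $T_{\mathcal{W},w}:\mathcal{K}_{\mathcal{W}}\to\mathcal{H}$, $T_{\mathcal{W},w}\{f_i\}_{i\in I}=\sum_{i\in I}w_if_i$, and the analysis operator is its adjoint $T^{*}_{\mathcal{W},w}:\mathcal{H}\to\mathcal{K}_{\mathcal{W}}$,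 $T^{*}_{\mathcal{W},w}f=\{w_i\pi_{W_i}(f)\}_{i\in I}$. For a fusion frame, the fusion frame operator $S_{\mathcal{W},w}=T_{\mathcal{W},w}T^{*}_{\mathcal{W},w}$ is positive, selfadjoint and invertible. For $i\in I$, $p_i$ denotes the coordinate projection $p_i\{f_j\}_{j\in I}=\{\delta_{i,j}f_j\}_{j\in I}$, on $\mathcal{K}_{\mathcal{W}}$ and likewise on $\mathcal{K}_{\mathcal{V}}$. Let $(\mathcal{W},w)$ and $(\mathcal{V},v)$ be fusion frames for $\mathcal{H}$. $(\mathcal{V},v)$ is a dual fusion frame ($Q$-dual fusion frame) of $(\mathcal{W},w)$ if there exists $Q\in L(\mathcal{K}_{\mathcal{W}},\mathcal{K}_{\mathcal{V}})$ such that $T_{\mathcal{V},v}QT^{*}_{\mathcal{W},w}=I_{\mathcal{H}}$. If moreover such a $Q$ satisfies $Qp_i\mathcal{K}_{\mathcal{W}}=p_i\mathcal{K}_{\mathcal{V}}$ for every $i\in I$, then $Q$ is called component preserving and $(\mathcal{V},v)$ a ($Q$-)component preserving dual fusion frame of $(\mathcal{W},w)$. *)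

theory Defs
  imports "HOL-Analysis.Analysis" "HOL-Library.Function_Algebras"
begin

text \<open>
  The scalar field is real or complex.  A \<open>real_normed_field\<close> has a multiplicative norm, so it is
  a copy of one of these two fields, and the second axiom then leaves ordinary conjugation as the
  only choice for \<open>kconj\<close>.
\<close>

class hilbert_scalar = real_normed_field +
  fixes kconj :: "'a \<Rightarrow> 'a"
  assumes kconj_add: "kconj (a + b) = kconj a + kconj b"
    and kconj_mult_self: "kconj a * a = (norm a)\<^sup>2 *\<^sub>R 1"

instantiation real :: hilbert_scalar
begin

definition kconj_real :: "real \<Rightarrow> real" where
  "kconj_real a = a"

instance
  by standard (simp_all add: kconj_real_def power2_eq_square)

end

instantiation complex :: hilbert_scalar
begin

definition kconj_complex :: "complex \<Rightarrow> complex" where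
  "kconj_complex a = cnj a"

instance
proof
  fix a b :: complex
  show "kconj (a + b) = kconj a + kconj b"
    by (simp add: kconj_complex_def)
  show "kconj a * a = (norm a)\<^sup>2 *\<^sub>R 1"
    unfolding kconj_complex_def scaleR_conv_of_real by (metis complex_norm_square mult.commute mult.right_neutral)
qed

end

text \<open>
  Completeness of the norm induced by \<open>ip\<close> comes from the class \<open>banach\<close>, and separability from
  \<open>second_countable_topology\<close>.
\<close>

locale separable_hilbert_space = vector_space smul
  for smul :: "'k::hilbert_scalar \<Rightarrow> 'h::{banach,second_countable_topology} \<Rightarrow> 'h" +
  fixes ip :: "'h \<Rightarrow> 'h \<Rightarrow> 'k"
  assumes scale_of_real: "smul (of_real r) x = r *\<^sub>R x"
    and ip_add_left: "ip (x + y) z = ip x z + ip y z"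
    and ip_scale_left: "ip (smul c x) y = c * ip x y"
    and ip_commute: "ip y x = kconj (ip x y)"
    and ip_self: "ip x x = of_real ((norm x)\<^sup>2)"

definition orth_proj :: "('h::real_normed_vector \<Rightarrow> 'h \<Rightarrow> 'k::zero) \<Rightarrow> 'h set \<Rightarrow> 'h \<Rightarrow> 'h" where
  "orth_proj ip V x = (THE y. y \<in> V \<and> (\<forall>z\<in>V. ip (x - y) z = 0))"

text \<open>
  Bounded linear operators between spaces \<open>X\<close> and \<open>Y\<close>, each given by scalar multiplication, norm
  and carrier.  Only the values on the carrier matter.
\<close>

definition bounded_operators ::
  "('k \<Rightarrow> 'a::plus \<Rightarrow> 'a) \<Rightarrow> ('a \<Rightarrow> real) \<Rightarrow> 'a set \<Rightarrow>
   ('k \<Rightarrow> 'b::plus \<Rightarrow> 'b) \<Rightarrow> ('b \<Rightarrow> real) \<Rightarrow> 'b set \<Rightarrow> ('a \<Rightarrow> 'b) set" where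
  "bounded_operators sX nX X sY nY Y =
     {F. (\<forall>f\<in>X. F f \<in> Y) \<and>
         (\<forall>f\<in>X. \<forall>g\<in>X. F (f + g) = F f + F g) \<and>
         (\<forall>c. \<forall>f\<in>X. F (sX c f) = sY c (F f)) \<and>
         (\<exists>B. \<forall>f\<in>X. nY (F f) \<le> B * nX f)}"

text \<open>
  Families indexed by \<open>I\<close> are functions on the whole type; elements of the direct sum vanish
  outside \<open>I\<close>, so that distinct functions are distinct elements.
\<close>

definition direct_sum :: "'i set \<Rightarrow> ('i \<Rightarrow> 'h::real_normed_vector set) \<Rightarrow> ('i \<Rightarrow> 'h) set" where
  "direct_sum I W =
     {f. (\<forall>i\<in>I. f i \<in> W i) \<and> (\<forall>i. i \<notin> I \<longrightarrow> f i = 0) \<and> (\<lambda>i. (norm (f i))\<^sup>2) summable_on I}"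

text \<open>The norm induced by the inner product \<open>\<Sum>i\<in>I. \<langle>f i, g i\<rangle>\<close>.\<close>

definition sum_norm :: "'i set \<Rightarrow> ('i \<Rightarrow> 'h::real_normed_vector) \<Rightarrow> real" where
  "sum_norm I f = sqrt (\<Sum>\<^sub>\<infinity>i\<in>I. (norm (f i))\<^sup>2)"

definition sum_scale :: "('k \<Rightarrow> 'h \<Rightarrow> 'h) \<Rightarrow> 'k \<Rightarrow> ('i \<Rightarrow> 'h) \<Rightarrow> ('i \<Rightarrow> 'h)" where
  "sum_scale smul c f = (\<lambda>i. smul c (f i))"

definition coord_proj :: "'i \<Rightarrow> ('i \<Rightarrow> 'h::zero) \<Rightarrow> ('i \<Rightarrow> 'h)" where
  "coord_proj i f = (\<lambda>j. if j = i then f j else 0)"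

definition weights :: "'i set \<Rightarrow> ('i \<Rightarrow> real) \<Rightarrow> bool" where
  "weights I w \<longleftrightarrow> (\<forall>i\<in>I. w i > 0) \<and> bounded (w ` I)"

definition weighted_subspaces ::
  "('k::field \<Rightarrow> 'h::real_normed_vector \<Rightarrow> 'h) \<Rightarrow> 'i set \<Rightarrow> ('i \<Rightarrow> 'h set) \<Rightarrow> ('i \<Rightarrow> real) \<Rightarrow> bool" where
  "weighted_subspaces smul I W w \<longleftrightarrow>
     weights I w \<and> (\<forall>i\<in>I. module.subspace smul (W i) \<and> closed (W i))"

text \<open>Summability is required separately because a divergent \<open>infsum\<close> has the value \<open>0\<close>.\<close>

definition bessel_fusion_sequence ::
  "('k::field \<Rightarrow> 'h::real_normed_vector \<Rightarrow> 'h) \<Rightarrow> ('h \<Rightarrow> 'h \<Rightarrow> 'k) \<Rightarrow>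
   'i set \<Rightarrow> ('i \<Rightarrow> 'h set) \<Rightarrow> ('i \<Rightarrow> real) \<Rightarrow> bool" where
  "bessel_fusion_sequence smul ip I W w \<longleftrightarrow>
     weighted_subspaces smul I W w \<and>
     (\<exists>\<beta>>0. \<forall>f. (\<lambda>i. (w i)\<^sup>2 * (norm (orth_proj ip (W i) f))\<^sup>2) summable_on I \<and>
        (\<Sum>\<^sub>\<infinity>i\<in>I. (w i)\<^sup>2 * (norm (orth_proj ip (W i) f))\<^sup>2) \<le> \<beta> * (norm f)\<^sup>2)"

definition fusion_frame ::
  "('k::field \<Rightarrow> 'h::real_normed_vector \<Rightarrow> 'h) \<Rightarrow> ('h \<Rightarrow> 'h \<Rightarrow> 'k) \<Rightarrow>
   'i set \<Rightarrow> ('i \<Rightarrow> 'h set) \<Rightarrow> ('i \<Rightarrow> real) \<Rightarrow> bool" where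
  "fusion_frame smul ip I W w \<longleftrightarrow>
     weighted_subspaces smul I W w \<and>
     (\<exists>\<alpha> \<beta>. 0 < \<alpha> \<and> \<alpha> \<le> \<beta> \<and>
       (\<forall>f. (\<lambda>i. (w i)\<^sup>2 * (norm (orth_proj ip (W i) f))\<^sup>2) summable_on I \<and>
          \<alpha> * (norm f)\<^sup>2 \<le> (\<Sum>\<^sub>\<infinity>i\<in>I. (w i)\<^sup>2 * (norm (orth_proj ip (W i) f))\<^sup>2) \<and>
          (\<Sum>\<^sub>\<infinity>i\<in>I. (w i)\<^sup>2 * (norm (orth_proj ip (W i) f))\<^sup>2) \<le> \<beta> * (norm f)\<^sup>2))"

definition synthesis :: "'i set \<Rightarrow> ('i \<Rightarrow> real) \<Rightarrow> ('i \<Rightarrow> 'h::real_normed_vector) \<Rightarrow> 'h" where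
  "synthesis I w f = (\<Sum>\<^sub>\<infinity>i\<in>I. w i *\<^sub>R f i)"

text \<open>The adjoint of the synthesis operator on \<open>direct_sum I W\<close>, given by its explicit formula.\<close>

definition analysis ::
  "('h \<Rightarrow> 'h \<Rightarrow> 'k::zero) \<Rightarrow> 'i set \<Rightarrow> ('i \<Rightarrow> 'h::real_normed_vector set) \<Rightarrow> ('i \<Rightarrow> real) \<Rightarrow>
   'h \<Rightarrow> ('i \<Rightarrow> 'h)" where
  "analysis ip I W w f = (\<lambda>i. if i \<in> I then w i *\<^sub>R orth_proj ip (W i) f else 0)"

definition frame_operator ::
  "('h \<Rightarrow> 'h \<Rightarrow> 'k::zero) \<Rightarrow> 'i set \<Rightarrow> ('i \<Rightarrow> 'h::real_normed_vector set) \<Rightarrow> ('i \<Rightarrow> real) \<Rightarrow>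
   'h \<Rightarrow> 'h" where
  "frame_operator ip I W w f = synthesis I w (analysis ip I W w f)"

definition component_preserving_dual ::
  "('k::field \<Rightarrow> 'h::real_normed_vector \<Rightarrow> 'h) \<Rightarrow> ('h \<Rightarrow> 'h \<Rightarrow> 'k) \<Rightarrow> 'i set \<Rightarrow>
   ('i \<Rightarrow> 'h set) \<Rightarrow> ('i \<Rightarrow> real) \<Rightarrow> ('i \<Rightarrow> 'h set) \<Rightarrow> ('i \<Rightarrow> real) \<Rightarrow> bool" where
  "component_preserving_dual smul ip I W w V v \<longleftrightarrow>
     fusion_frame smul ip I W w \<and> fusion_frame smul ip I V v \<and>
     (\<exists>Q \<in> bounded_operators (sum_scale smul) (sum_norm I) (direct_sum I W)
                              (sum_scale smul) (sum_norm I) (direct_sum I V).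
        (\<forall>f. synthesis I v (Q (analysis ip I W w f)) = f) \<and>
        (\<forall>i\<in>I. Q ` coord_proj i ` direct_sum I W = coord_proj i ` direct_sum I V))"

end

theory Submission
  imports Defs
begin

text \<open>
  Every \<open>A = S\<^sup>-\<^sup>1 T + R (1 - T\<^sup>* S\<^sup>-\<^sup>1 T)\<close> satisfies \<open>A T\<^sup>* = 1\<close>, and every bounded left inverse \<open>A\<close> of
  the analysis operator \<open>T\<^sup>*\<close> arises in this way, with \<open>R = A\<close>.  If \<open>V\<close> is a \<open>Q\<close>-component preserving
  dual, then \<open>A = T\<^sub>V Q\<close> is such a left inverse and maps \<open>p\<^sub>i K\<^sub>W\<close> onto \<open>v\<^sub>i V\<^sub>i = V\<^sub>i\<close>.  Conversely, if
  \<open>V\<^sub>i = A p\<^sub>i K\<^sub>W\<close>, then \<open>Q f = (A p\<^sub>i f / v\<^sub>i)\<^sub>i\<close> is bounded because \<open>v\<^sub>i > \<delta>\<close>, and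
  \<open>T\<^sub>V Q f = (\<Sum>i. A p\<^sub>i f) = A f\<close>, so \<open>T\<^sub>V Q T\<^sup>* = 1\<close>.  The lower frame bound of \<open>V\<close> then follows from
  \<open>\<parallel>x\<parallel>\<^sup>2 = \<langle>T\<^sub>V Q T\<^sup>* x, x\<rangle> \<le> \<parallel>Q T\<^sup>* x\<parallel> \<parallel>T\<^sub>V\<^sup>* x\<parallel>\<close>.
\<close>

section \<open>Inner products and orthogonal projections\<close>

text \<open>For \<open>a \<noteq> 0\<close> the axiom \<open>kconj_mult_self\<close> determines
  \<open>kconj a\<close> by division; at zero, additivity forces \<open>kconj 0 = 0\<close>, in
  agreement with \<open>x / 0 = 0\<close>. Multiplicativity and the action on reals, which are not
  axioms, are read off this formula.\<close>

lemma kconj_eq: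
  fixes a :: "'k::hilbert_scalar"
  shows "kconj a = of_real ((norm a)\<^sup>2) / a"
proof (cases "a = 0")
  case True
  have "kconj (0::'k) = kconj 0 + kconj 0"
    using kconj_add[of "0::'k" 0] by simp
  then show ?thesis using True by simp
next
  case False
  then show ?thesis
    using kconj_mult_self[of a] by (simp add: field_simps of_real_def)
qed

lemma kconj_0 [simp]: "kconj (0::'k::hilbert_scalar) = 0"
  by (simp add: kconj_eq)

lemma kconj_mult: "kconj (a * b) = kconj a * kconj (b::'k::hilbert_scalar)"
  by (simp add: kconj_eq norm_mult power_mult_distrib)

lemma kconj_of_real [simp]: "kconj (of_real r :: 'k::hilbert_scalar) = of_real r"
  by (cases "r = 0") (simp_all add: kconj_eq power2_eq_square)

lemma mult_kconj: "a * kconj a = of_real ((norm (a::'k::hilbert_scalar))\<^sup>2)"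
  by (simp add: kconj_eq)

text \<open>Small tails of \<open>h\<close> make the finite sums of \<open>f\<close> a Cauchy net,
  and completeness gives the limit; the bound then passes to the limit. The hypothesis concerns
  norms of sums rather than sums of norms, so it covers series that need not converge
  absolutely.\<close>

lemma dominated_summable:
  fixes f :: "'i \<Rightarrow> 'h::banach" and h :: "'i \<Rightarrow> real"
  assumes h: "h summable_on A" "\<And>i. i \<in> A \<Longrightarrow> 0 \<le> h i" and "0 \<le> C"
    and dom: "\<And>F. finite F \<Longrightarrow> F \<subseteq> A \<Longrightarrow> (norm (sum f F))\<^sup>2 \<le> C * sum h F"
  shows "f summable_on A" and "(norm (infsum f A))\<^sup>2 \<le> C * infsum h A"
proof -
  have *: "\<exists>F0. finite F0 \<and> F0 \<subseteq> A \<and> (\<forall>F. finite F \<and> F0 \<subseteq> F \<and> F \<subseteq> A \<longrightarrow> norm (sum f F - sum f F0) < e)"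
    if "e > 0" for e
  proof -
    obtain d where d: "d > 0" "C * d < e\<^sup>2"
    proof
      \<comment> \<open>The added 1 keeps the denominator positive when \<open>C = 0\<close> and
        makes the second inequality strict.\<close>
      show "e\<^sup>2 / (C + 1) > 0" "C * (e\<^sup>2 / (C + 1)) < e\<^sup>2"
        using \<open>e > 0\<close> \<open>0 \<le> C\<close> by (auto simp: field_simps)
    qed
    obtain F0 where F0: "finite F0" "F0 \<subseteq> A" "dist (sum h F0) (infsum h A) \<le> d"
      using infsum_finite_approximation[OF h(1) d(1)] by blast
    have "norm (sum f F - sum f F0) < e" if F: "finite F" "F0 \<subseteq> F" "F \<subseteq> A" for F
    proof -
      have "sum h F \<le> infsum h A"
        by (rule finite_sum_le_infsum) (use h F in auto)
      then have "sum h (F - F0) \<le> d"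
        using F0 F by (auto simp: sum_diff dist_real_def)
      then have "(norm (sum f (F - F0)))\<^sup>2 \<le> C * d"
        using dom[of "F - F0"] F mult_left_mono[of "sum h (F - F0)" d C] \<open>0 \<le> C\<close> by fastforce
      then have "norm (sum f (F - F0)) < e"
        using d(2) \<open>e > 0\<close> by (intro power2_less_imp_less[of _ e]) auto
      then show ?thesis
        using F by (simp add: sum_diff)
    qed
    then show ?thesis using F0 by blast
  qed
  have "\<exists>P. eventually P (finite_subsets_at_top A) \<and>
          (\<forall>F F'. P F \<and> P F' \<longrightarrow> dist (sum f F) (sum f F') < e)" if "e > 0" for e
  proof -
    from that have "e / 2 > 0" by simp
    from *[OF this] obtain F0 where F0: "finite F0" "F0 \<subseteq> A"
      "\<forall>F. finite F \<and> F0 \<subseteq> F \<and> F \<subseteq> A \<longrightarrow> norm (sum f F - sum f F0) < e / 2"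
      by (elim exE conjE)
    show ?thesis
    proof (intro exI conjI allI impI)
      show "eventually (\<lambda>F. finite F \<and> F0 \<subseteq> F \<and> F \<subseteq> A) (finite_subsets_at_top A)"
        using F0 by (auto simp: eventually_finite_subsets_at_top)
      show "dist (sum f F) (sum f F') < e"
        if "(finite F \<and> F0 \<subseteq> F \<and> F \<subseteq> A) \<and> finite F' \<and> F0 \<subseteq> F' \<and> F' \<subseteq> A" for F F'
      proof (rule dist_triangle_half_r)
        show "dist (sum f F0) (sum f F) < e / 2" "dist (sum f F0) (sum f F') < e / 2"
          unfolding dist_norm norm_minus_commute[of "sum f F0"] by (rule F0(3)[rule_format], use that in blast)+
      qed
    qed
  qed
  then have "cauchy_filter (filtermap (sum f) (finite_subsets_at_top A))"
    by (simp add: cauchy_filter_metric_filtermap)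
  then obtain L where "(sum f \<longlongrightarrow> L) (finite_subsets_at_top A)"
    using complete_uniform[where S="UNIV :: 'h set"] complete_UNIV by (force simp add: filterlim_def)
  then show sf: "f summable_on A"
    unfolding summable_on_def has_sum_def by blast
  have "((\<lambda>F. (norm (sum f F))\<^sup>2) \<longlongrightarrow> (norm (infsum f A))\<^sup>2) (finite_subsets_at_top A)"
    by (intro tendsto_intros infsum_tendsto sf)
  moreover have "((\<lambda>F. C * sum h F) \<longlongrightarrow> C * infsum h A) (finite_subsets_at_top A)"
    by (intro tendsto_intros infsum_tendsto h)
  ultimately show "(norm (infsum f A))\<^sup>2 \<le> C * infsum h A"
    using dom by (intro tendsto_le[OF finite_subsets_at_top_neq_bot])
      (auto intro!: eventually_finite_subsets_at_top_weakI)
qed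

section \<open>Inner product identities, Cauchy-Schwarz and the projection theorem\<close>

context separable_hilbert_space
begin

lemma ip_scaleR_left: "ip (r *\<^sub>R x) y = of_real r * ip x y"
  by (simp only: scale_of_real[symmetric] ip_scale_left)

lemma ip_add_right: "ip x (y + z) = ip x y + ip x z"
  by (simp only: ip_commute[where y = x] ip_add_left kconj_add)

lemma ip_scale_right: "ip x (smul c y) = kconj c * ip x y"
  by (simp only: ip_commute[where y = x] ip_scale_left kconj_mult)

lemma ip_scaleR_right: "ip x (r *\<^sub>R y) = of_real r * ip x y"
  by (simp only: scale_of_real[symmetric] ip_scale_right kconj_of_real)

lemma ip_0_left [simp]: "ip 0 x = 0" and ip_0_right [simp]: "ip x 0 = 0"
  using ip_scaleR_left[of 0 0 x] ip_scaleR_right[of x 0 0] by simp_all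

lemma ip_minus_left: "ip (- x) y = - ip x y" and ip_minus_right: "ip x (- y) = - ip x y"
  using ip_scaleR_left[of "-1" x y] ip_scaleR_right[of x "-1" y] by simp_all

lemma ip_diff_left: "ip (x - y) z = ip x z - ip y z"
  using ip_add_left[of x "-y" z] by (simp add: ip_minus_left)

lemma ip_diff_right: "ip x (y - z) = ip x y - ip x z"
  using ip_add_right[of x y "-z"] by (simp add: ip_minus_right)

lemma ip_sum_left: "ip (\<Sum>i\<in>F. f i) y = (\<Sum>i\<in>F. ip (f i) y)"
  by (induction F rule: infinite_finite_induct) (simp_all add: ip_add_left)

text \<open>The type class gives homogeneity of the norm for real scalars only. For scalars in
  \<open>'k\<close> it comes from \<open>ip_self\<close>, where the factor
  \<open>c * kconj c\<close> appears.\<close>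

lemma norm_smul: "norm (smul c x) = norm c * norm x"
proof -
  have "(of_real ((norm (smul c x))\<^sup>2) :: 'k) = of_real ((norm c * norm x)\<^sup>2)"
    by (simp only: ip_self[symmetric] ip_scale_left ip_scale_right power_mult_distrib of_real_mult
        mult_kconj[symmetric] mult.assoc mult.left_commute[of c])
  then show ?thesis
    by (simp only: of_real_eq_iff power2_eq_iff_nonneg norm_ge_zero mult_nonneg_nonneg)
qed

text \<open>Stated in \<open>'k\<close>, where the cross terms can stand without a real part
  function; injectivity of \<open>of_real\<close> later brings the identities back to the
  reals.\<close>

lemma norm_diff_square:
  "of_real ((norm (x - y))\<^sup>2) = (of_real ((norm x)\<^sup>2) + of_real ((norm y)\<^sup>2) - (ip x y + ip y x) :: 'k)"
  by (simp add: ip_self[symmetric] ip_diff_left ip_diff_right del: of_real_power)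

lemma norm_add_square:
  "of_real ((norm (x + y))\<^sup>2) = (of_real ((norm x)\<^sup>2) + of_real ((norm y)\<^sup>2) + (ip x y + ip y x) :: 'k)"
  by (simp add: ip_self[symmetric] ip_add_left ip_add_right del: of_real_power)

lemma parallelogram:
  fixes x y :: 'h
  shows "(norm (x + y))\<^sup>2 + (norm (x - y))\<^sup>2 = 2 * (norm x)\<^sup>2 + 2 * (norm y)\<^sup>2"
proof -
  have "(of_real ((norm (x + y))\<^sup>2 + (norm (x - y))\<^sup>2) :: 'k) = of_real (2 * (norm x)\<^sup>2 + 2 * (norm y)\<^sup>2)"
    by (simp only: of_real_add norm_add_square norm_diff_square of_real_mult) simp
  then show ?thesis by (simp only: of_real_eq_iff)
qed

text \<open>The subtracted multiple is the projection of \<open>x\<close> onto the line through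
  \<open>z\<close>. That the right-hand side is nonnegative is Cauchy-Schwarz; that it drops below
  \<open>(norm x)\<^sup>2\<close> unless \<open>ip x z = 0\<close> forces closest points to have
  orthogonal residuals.\<close>

lemma norm_diff_best_multiple:
  assumes "z \<noteq> 0"
  shows "(norm (x - smul (ip x z / of_real ((norm z)\<^sup>2)) z))\<^sup>2 = (norm x)\<^sup>2 - (norm (ip x z))\<^sup>2 / (norm z)\<^sup>2"
proof -
  let ?t = "ip x z / of_real ((norm z)\<^sup>2)"
  have 1: "ip (smul ?t z) x = of_real ((norm (ip x z))\<^sup>2 / (norm z)\<^sup>2)"
    using ip_commute[of z x] by (simp add: ip_scale_left mult_kconj)
  have 2: "ip x (smul ?t z) = of_real ((norm (ip x z))\<^sup>2 / (norm z)\<^sup>2)"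
    using ip_commute[of x "smul ?t z"] by (simp only: 1 kconj_of_real)
  have 3: "(norm (smul ?t z))\<^sup>2 = (norm (ip x z))\<^sup>2 / (norm z)\<^sup>2"
    using assms by (simp add: norm_smul norm_divide power_divide power_mult_distrib norm_power field_simps power2_eq_square norm_mult)
  have "(of_real ((norm (x - smul ?t z))\<^sup>2) :: 'k) = of_real ((norm x)\<^sup>2 - (norm (ip x z))\<^sup>2 / (norm z)\<^sup>2)"
    by (simp only: norm_diff_square 1 2 3 of_real_diff) simp
  then show ?thesis by (simp only: of_real_eq_iff)
qed

lemma cauchy_schwarz: "norm (ip x y) \<le> norm x * norm y"
proof (cases "y = 0")
  case False
  have "0 \<le> (norm x)\<^sup>2 - (norm (ip x y))\<^sup>2 / (norm y)\<^sup>2"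
    using norm_diff_best_multiple[OF False, of x] zero_le_power2 by metis
  then have "(norm (ip x y))\<^sup>2 \<le> (norm x * norm y)\<^sup>2"
    using False by (simp add: power_mult_distrib field_simps)
  then show ?thesis
    by (rule power2_le_imp_le) simp
qed simp

lemma bounded_linear_ip_left: "bounded_linear (\<lambda>x. ip x y)"
  by (rule bounded_linear_intro[of _ "norm y"])
    (auto simp: ip_add_left ip_scaleR_left cauchy_schwarz scaleR_conv_of_real)

text \<open>A minimizing sequence is Cauchy by the parallelogram law, and its limit stays in the
  closed set \<open>V\<close> and attains the infimum.\<close>

lemma ex_closest_point:
  assumes "subspace V" "closed V"
  shows "\<exists>y\<in>V. \<forall>z\<in>V. norm (x - y) \<le> norm (x - z)"
proof -
  define d where "d = infdist x V"
  have V0: "0 \<in> V" using assms(1) by (rule subspace_0)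
  have dle: "d \<le> norm (x - z)" if "z \<in> V" for z
    using infdist_le[OF that, of x] by (simp add: d_def dist_norm)
  \<comment> \<open>The slack is put on the squared distance, the quantity that enters the
    parallelogram law.\<close>
  have "\<exists>y\<in>V. (norm (x - y))\<^sup>2 < d\<^sup>2 + inverse (real (Suc n))" for n
  proof -
    have "d < sqrt (d\<^sup>2 + inverse (real (Suc n)))"
      by (rule real_less_rsqrt) simp
    then obtain y where "y \<in> V" "norm (x - y) < sqrt (d\<^sup>2 + inverse (real (Suc n)))"
      using V0 cInf_lessD[of "dist x ` V"] unfolding d_def infdist_def dist_norm[symmetric]
      by (auto split: if_splits)
    then have "(norm (x - y))\<^sup>2 < d\<^sup>2 + inverse (real (Suc n))"
      using power_strict_mono[of "norm (x - y)" "sqrt (d\<^sup>2 + inverse (real (Suc n)))" 2] by simp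
    then show ?thesis using \<open>y \<in> V\<close> by blast
  qed
  then obtain y where yV: "\<And>n. y n \<in> V" and y: "\<And>n. (norm (x - y n))\<^sup>2 < d\<^sup>2 + inverse (real (Suc n))"
    by metis
  have close: "(norm (y m - y n))\<^sup>2 \<le> 2 * inverse (real (Suc m)) + 2 * inverse (real (Suc n))" for m n
  proof -
    \<comment> \<open>The midpoint lies in \<open>V\<close>, so its distance to \<open>x\<close> is
      at least \<open>d\<close>; this bounds the sum term of the parallelogram law from below and
      leaves only the slacks for the difference.\<close>
    let ?z = "(1/2) *\<^sub>R (y m + y n)"
    have "?z \<in> V"
      using assms(1) yV by (metis scale_of_real subspace_add subspace_scale)
    then have "d\<^sup>2 \<le> (norm (x - ?z))\<^sup>2"
      using dle by (intro power_mono) (simp_all add: d_def infdist_nonneg)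
    moreover have "(x - y m) + (x - y n) = 2 *\<^sub>R (x - ?z)"
      by (simp add: algebra_simps scaleR_2)
    then have "(norm ((x - y m) + (x - y n)))\<^sup>2 = 4 * (norm (x - ?z))\<^sup>2"
      by (simp add: power_mult_distrib)
    moreover have "norm ((x - y m) - (x - y n)) = norm (y m - y n)"
      by (simp add: norm_minus_commute)
    ultimately show ?thesis
      using parallelogram[of "x - y m" "x - y n"] y[of m] y[of n] by simp
  qed
  have "Cauchy y"
  proof (rule metric_CauchyI)
    fix e :: real assume "e > 0"
    \<comment> \<open>Each of the two terms of \<open>close\<close> is then below
      \<open>e\<^sup>2 / 2\<close>.\<close>
    then obtain N where N: "inverse (real (Suc N)) < e\<^sup>2 / 4"
      using reals_Archimedean[of "e\<^sup>2 / 4"] by auto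
    have "dist (y m) (y n) < e" if "m \<ge> N" "n \<ge> N" for m n
    proof -
      have "inverse (real (Suc m)) \<le> inverse (real (Suc N))" "inverse (real (Suc n)) \<le> inverse (real (Suc N))"
        using that by auto
      then have "(norm (y m - y n))\<^sup>2 < e\<^sup>2"
        using close[of m n] N by linarith
      then show ?thesis
        using \<open>e > 0\<close> by (simp add: dist_norm power2_less_imp_less)
    qed
    then show "\<exists>M. \<forall>m\<ge>M. \<forall>n\<ge>M. dist (y m) (y n) < e" by blast
  qed
  then obtain l where l: "y \<longlonglongrightarrow> l"
    using convergent_eq_Cauchy by blast
  have "l \<in> V"
    using assms(2) yV l closed_sequentially by blast
  moreover have "norm (x - l) \<le> d"
  proof -
    have "(\<lambda>n. (norm (x - y n))\<^sup>2) \<longlonglongrightarrow> (norm (x - l))\<^sup>2"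
      by (intro tendsto_intros l)
    moreover have "(\<lambda>n. d\<^sup>2 + inverse (real (Suc n))) \<longlonglongrightarrow> d\<^sup>2 + 0"
      by (intro tendsto_intros LIMSEQ_inverse_real_of_nat)
    ultimately have "(norm (x - l))\<^sup>2 \<le> d\<^sup>2 + 0"
      by (rule LIMSEQ_le) (use y less_imp_le in blast)
    then show ?thesis
      by (simp add: d_def infdist_nonneg)
  qed
  ultimately show ?thesis using dle by force
qed

text \<open>Since \<open>orth_proj\<close> is a definite description, it has its defining property
  only once a unique such point is known to exist; the closest point supplies existence.\<close>

lemma orth_proj:
  assumes "subspace V" "closed V"
  shows "orth_proj ip V x \<in> V \<and> (\<forall>z\<in>V. ip (x - orth_proj ip V x) z = 0)"
  unfolding orth_proj_def
proof (rule theI')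
  obtain y where y: "y \<in> V" "\<And>z. z \<in> V \<Longrightarrow> norm (x - y) \<le> norm (x - z)"
    using ex_closest_point[OF assms] by blast
  have "ip (x - y) z = 0" if "z \<in> V" for z
  proof (rule ccontr)
    assume nz: "ip (x - y) z \<noteq> 0"
    then have "z \<noteq> 0" by auto
    \<comment> \<open>If the residual were not orthogonal to \<open>z\<close>, adding this multiple
      of \<open>z\<close> to \<open>y\<close> would stay in \<open>V\<close> and come strictly
      closer to \<open>x\<close>.\<close>
    let ?u = "smul (ip (x - y) z / of_real ((norm z)\<^sup>2)) z"
    have "y + ?u \<in> V"
      using assms(1) y(1) that by (simp add: subspace_add subspace_scale)
    then have "(norm (x - y))\<^sup>2 \<le> (norm (x - y - ?u))\<^sup>2"
      using y(2)[of "y + ?u"] by (simp add: diff_diff_add power_mono)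
    then show False
      using nz \<open>z \<noteq> 0\<close> unfolding norm_diff_best_multiple[OF \<open>z \<noteq> 0\<close>] by (simp add: field_simps)
  qed
  moreover have "y' = y" if y': "y' \<in> V" "\<forall>z\<in>V. ip (x - y') z = 0" and "\<forall>z\<in>V. ip (x - y) z = 0" for y'
  proof -
    \<comment> \<open>Both residuals are orthogonal to \<open>y' - y\<close>, so this vector is
      orthogonal to itself.\<close>
    have "y' - y \<in> V" using subspace_diff[OF assms(1) y'(1) y(1)] .
    then have "ip (x - y) (y' - y) - ip (x - y') (y' - y) = 0"
      using that by simp
    then have "ip (y' - y) (y' - y) = 0" by (simp add: ip_diff_left)
    then show ?thesis by (simp add: ip_self)
  qed
  ultimately show "\<exists>!y. y \<in> V \<and> (\<forall>z\<in>V. ip (x - y) z = 0)"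
    using y(1) by blast
qed

lemma orth_proj_in: "subspace V \<Longrightarrow> closed V \<Longrightarrow> orth_proj ip V x \<in> V"
  using orth_proj by blast

lemma ip_orth_proj:
  assumes "subspace V" "closed V" "y \<in> V"
  shows "ip (orth_proj ip V x) y = ip x y" "ip y (orth_proj ip V x) = ip y x"
proof -
  show 1: "ip (orth_proj ip V x) y = ip x y"
    using bspec[OF conjunct2[OF orth_proj[OF assms(1,2), of x]] assms(3)]
    unfolding ip_diff_left by (metis right_minus_eq)
  show "ip y (orth_proj ip V x) = ip y x"
    by (simp only: ip_commute[where y = y] 1)
qed

lemma orth_proj_unique:
  assumes "subspace V" "closed V" "y \<in> V" "\<And>z. z \<in> V \<Longrightarrow> ip (x - y) z = 0"
  shows "orth_proj ip V x = y"
proof -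
  let ?z = "orth_proj ip V x - y"
  have "?z \<in> V"
    using assms by (simp add: orth_proj_in subspace_diff)
  then have "ip ?z ?z = 0"
    using ip_orth_proj(1)[OF assms(1,2), of ?z x] assms(4)[of ?z] by (simp add: ip_diff_left)
  then show ?thesis by (simp add: ip_self)
qed

lemma orth_proj_add:
  assumes "subspace V" "closed V"
  shows "orth_proj ip V (x + y) = orth_proj ip V x + orth_proj ip V y"
proof (rule orth_proj_unique[OF assms])
  show "orth_proj ip V x + orth_proj ip V y \<in> V"
    by (intro subspace_add orth_proj_in assms)
  show "ip (x + y - (orth_proj ip V x + orth_proj ip V y)) z = 0" if "z \<in> V" for z
    by (simp add: ip_diff_left ip_add_left ip_orth_proj(1)[OF assms that])
qed

lemma orth_proj_smul:
  assumes "subspace V" "closed V"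
  shows "orth_proj ip V (smul c x) = smul c (orth_proj ip V x)"
proof (rule orth_proj_unique[OF assms])
  show "smul c (orth_proj ip V x) \<in> V"
    by (intro subspace_scale orth_proj_in assms)
  show "ip (smul c x - smul c (orth_proj ip V x)) z = 0" if "z \<in> V" for z
    by (simp add: ip_diff_left ip_scale_left ip_orth_proj(1)[OF assms that])
qed

end

section \<open>Direct sums\<close>

text \<open>The definition allows any real bound. Raising it to \<open>max B 1\<close> is harmless
  for a nonnegative source norm and yields a positive constant, fit for monotonicity arguments and
  for division.\<close>

lemma bounded_operatorsE:
  assumes "F \<in> bounded_operators sX nX X sY nY Y" and nonneg: "\<And>f. f \<in> X \<Longrightarrow> 0 \<le> nX f"
  obtains B where "0 < B" "\<And>f. f \<in> X \<Longrightarrow> nY (F f) \<le> B * nX f"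
proof -
  obtain B where "\<And>f. f \<in> X \<Longrightarrow> nY (F f) \<le> B * nX f"
    using assms(1) unfolding bounded_operators_def by blast
  then have "nY (F f) \<le> max B 1 * nX f" if "f \<in> X" for f
    using that nonneg[OF that] by (meson max.cobounded1 mult_right_mono order_trans)
  then show ?thesis
    using that[of "max B 1"] by simp
qed

lemma sum_norm_nonneg [simp]: "0 \<le> sum_norm I f"
  by (simp add: sum_norm_def infsum_nonneg)

lemma sum_norm_square: "(sum_norm I f)\<^sup>2 = (\<Sum>\<^sub>\<infinity>i\<in>I. (norm (f i))\<^sup>2)"
  by (simp add: sum_norm_def infsum_nonneg)

lemma coord_proj_const: "coord_proj i f = coord_proj i (\<lambda>_. f i)"
  by (auto simp: coord_proj_def)

text \<open>Comparison of the squared norms coordinate by coordinate. The target family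
  \<open>V\<close> may differ from \<open>W\<close>, so that the lemma also serves operators between
  two direct sums.\<close>

lemma direct_sum_dominated:
  assumes "f \<in> direct_sum I W" and "0 \<le> C"
    and "\<And>i. i \<in> I \<Longrightarrow> g i \<in> V i" "\<And>i. i \<notin> I \<Longrightarrow> g i = 0"
    and le: "\<And>i. i \<in> I \<Longrightarrow> norm (g i) \<le> C * norm (f i)"
  shows "g \<in> direct_sum I V" and "sum_norm I g \<le> C * sum_norm I f"
proof -
  have sf: "(\<lambda>i. C\<^sup>2 * (norm (f i))\<^sup>2) summable_on I"
    using assms(1) by (auto simp: direct_sum_def intro: summable_on_cmult_right)
  have le2: "(norm (g i))\<^sup>2 \<le> C\<^sup>2 * (norm (f i))\<^sup>2" if "i \<in> I" for i
    using power_mono[OF le[OF that], of 2] by (simp add: power_mult_distrib)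
  have sg: "(\<lambda>i. (norm (g i))\<^sup>2) summable_on I"
    by (rule summable_on_comparison_test[OF sf]) (use le2 in auto)
  then show "g \<in> direct_sum I V"
    using assms by (simp add: direct_sum_def)
  have "(sum_norm I g)\<^sup>2 \<le> (C * sum_norm I f)\<^sup>2"
    using infsum_mono[OF sg sf le2] by (simp add: sum_norm_square power_mult_distrib infsum_cmult_right')
  then show "sum_norm I g \<le> C * sum_norm I f"
    using \<open>0 \<le> C\<close> by (intro power2_le_imp_le[OF _ mult_nonneg_nonneg]) auto
qed

context separable_hilbert_space
begin

lemma bounded_linear_smul: "bounded_linear (smul c)"
proof (rule bounded_linear_intro)
  show "smul c (x + y) = smul c x + smul c y" for x y
    by (rule scale_right_distrib)
  show "smul c (r *\<^sub>R x) = r *\<^sub>R smul c x" for r x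
    by (simp only: scale_of_real[symmetric] scale_scale mult.commute)
  show "norm (smul c x) \<le> norm x * norm c" for x
    by (simp add: norm_smul)
qed

lemma subspace_scaleR: "subspace V \<Longrightarrow> x \<in> V \<Longrightarrow> r *\<^sub>R x \<in> V"
  by (metis scale_of_real subspace_scale)

end

locale subspace_family = separable_hilbert_space smul ip
  for smul :: "'k::hilbert_scalar \<Rightarrow> 'h::{banach,second_countable_topology} \<Rightarrow> 'h" and ip +
  fixes I :: "'i set" and W :: "'i \<Rightarrow> 'h set"
  assumes subspace_W: "i \<in> I \<Longrightarrow> subspace (W i)"
    and closed_W: "i \<in> I \<Longrightarrow> closed (W i)"
begin

abbreviation "K \<equiv> direct_sum I W"

text \<open>Square summability follows from the parallelogram law after dropping the difference
  term.\<close>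

lemma K_add: assumes "f \<in> K" "g \<in> K" shows "f + g \<in> K"
proof -
  have "(\<lambda>i. 2 * (norm (f i))\<^sup>2 + 2 * (norm (g i))\<^sup>2) summable_on I"
    using assms by (auto simp: direct_sum_def intro!: summable_on_add summable_on_cmult_right)
  moreover have "(norm (f i + g i))\<^sup>2 \<le> 2 * (norm (f i))\<^sup>2 + 2 * (norm (g i))\<^sup>2" for i
    using parallelogram[of "f i" "g i"] zero_le_power2[of "norm (f i - g i)"] by linarith
  ultimately have "(\<lambda>i. (norm (f i + g i))\<^sup>2) summable_on I"
    by (rule summable_on_comparison_test) auto
  then show ?thesis
    using assms subspace_W by (auto simp: direct_sum_def subspace_add)
qed

lemma K_scale: "f \<in> K \<Longrightarrow> sum_scale smul c f \<in> K"
  by (rule direct_sum_dominated(1)[where f = f and C = "norm c"])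
    (auto simp: direct_sum_def sum_scale_def norm_smul subspace_scale subspace_W)

lemma K_diff: assumes "f \<in> K" "g \<in> K" shows "f - g \<in> K"
proof -
  have "f + sum_scale smul (-1) g \<in> K"
    by (intro K_add K_scale assms)
  then show ?thesis by (simp add: sum_scale_def plus_fun_def fun_diff_def)
qed

lemma K_restrict: "f \<in> K \<Longrightarrow> (\<lambda>j. if j \<in> F then f j else 0) \<in> K"
  by (rule direct_sum_dominated(1)[where f = f and C = 1])
    (auto simp: direct_sum_def subspace_0 subspace_W)

lemma K_0: "0 \<in> K"
  by (auto simp: direct_sum_def subspace_0 subspace_W)

lemma K_coord_proj: "f \<in> K \<Longrightarrow> coord_proj i f \<in> K"
  using K_restrict[of f "{i}"] by (simp add: coord_proj_def)

lemma K_single: assumes "i \<in> I" "x \<in> W i" shows "coord_proj i (\<lambda>_. x) \<in> K"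
proof -
  have "(\<lambda>j. (norm (coord_proj i (\<lambda>_. x) j))\<^sup>2) summable_on I"
    using summable_on_cong_neutral[of I "{i}" "\<lambda>j. (norm (coord_proj i (\<lambda>_. x) j))\<^sup>2" "\<lambda>_. (norm x)\<^sup>2"]
      assms(1) by (auto simp: coord_proj_def)
  then show ?thesis
    using assms by (auto simp: direct_sum_def coord_proj_def subspace_0 subspace_W)
qed

lemma coord_proj_image: "i \<in> I \<Longrightarrow> coord_proj i ` K = (\<lambda>x. coord_proj i (\<lambda>_. x)) ` W i"
proof (intro equalityI subsetI)
  fix g assume "i \<in> I" "g \<in> coord_proj i ` K"
  then obtain f where "f \<in> K" "g = coord_proj i f" by blast
  with \<open>i \<in> I\<close> show "g \<in> (\<lambda>x. coord_proj i (\<lambda>_. x)) ` W i"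
    using coord_proj_const[of i f] by (auto simp: direct_sum_def)
next
  fix g assume "i \<in> I" "g \<in> (\<lambda>x. coord_proj i (\<lambda>_. x)) ` W i"
  then obtain x where x: "x \<in> W i" "g = coord_proj i (\<lambda>_. x)" by blast
  then have "g = coord_proj i (coord_proj i (\<lambda>_. x))" by (auto simp: coord_proj_def)
  with x K_single[OF \<open>i \<in> I\<close>] show "g \<in> coord_proj i ` K" by blast
qed

lemma sum_norm_coord_proj: "i \<in> I \<Longrightarrow> sum_norm I (coord_proj i f) = norm (f i)"
proof -
  assume "i \<in> I"
  then have "(\<Sum>\<^sub>\<infinity>j\<in>I. (norm (coord_proj i f j))\<^sup>2) = (\<Sum>\<^sub>\<infinity>j\<in>{i}. (norm (f j))\<^sup>2)"
    by (intro infsum_cong_neutral) (auto simp: coord_proj_def)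
  then show ?thesis by (simp add: sum_norm_def)
qed

section \<open>Bounded operators from the direct sum into the Hilbert space\<close>

abbreviation "operators \<equiv> bounded_operators (sum_scale smul) (sum_norm I) K smul norm (UNIV :: 'h set)"

lemma operatorsD:
  assumes "A \<in> operators"
  shows "\<And>f g. f \<in> K \<Longrightarrow> g \<in> K \<Longrightarrow> A (f + g) = A f + A g"
    and "\<And>f g. f \<in> K \<Longrightarrow> g \<in> K \<Longrightarrow> A (f - g) = A f - A g"
    and "\<And>c f. f \<in> K \<Longrightarrow> A (sum_scale smul c f) = smul c (A f)"
    and "A 0 = 0"
proof -
  show add: "A (f + g) = A f + A g" if "f \<in> K" "g \<in> K" for f g
    using assms that by (simp add: bounded_operators_def)
  show "A (f - g) = A f - A g" if "f \<in> K" "g \<in> K" for f g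
    using add[OF K_diff[OF that] that(2)] by simp
  show "A (sum_scale smul c f) = smul c (A f)" if "f \<in> K" for c f
    using assms that by (simp add: bounded_operators_def)
  show "A 0 = 0"
    using add[OF K_0 K_0] by simp
qed

text \<open>The restrictions of \<open>f\<close> to finite index sets converge to \<open>f\<close>
  in \<open>K\<close>, because the tails of its square sum vanish, and boundedness of
  \<open>A\<close> carries this over to the values.\<close>

lemma operators_has_sum:
  assumes A: "A \<in> operators" and f: "f \<in> K"
  shows "((\<lambda>i. A (coord_proj i f)) has_sum A f) I"
proof -
  obtain B where B: "0 < B" "\<And>f. f \<in> K \<Longrightarrow> norm (A f) \<le> B * sum_norm I f"
    using A by (rule bounded_operatorsE) simp_all
  define h where "h = (\<lambda>i. (norm (f i))\<^sup>2)"
  have h: "h summable_on I" using f by (simp add: direct_sum_def h_def)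
  let ?r = "\<lambda>F j. if j \<in> F then f j else 0"
  have sum: "(\<Sum>i\<in>F. A (coord_proj i f)) = A (?r F)" if "finite F" for F
    using that
  proof (induction F)
    case empty
    then show ?case using operatorsD(4)[OF A] by (simp add: zero_fun_def)
  next
    case (insert i F)
    have "?r (insert i F) = coord_proj i f + ?r F"
      using insert.hyps(2) by (auto simp: coord_proj_def)
    then show ?case
      using operatorsD(1)[OF A K_coord_proj[OF f] K_restrict[OF f, of F]] insert by simp
  qed
  have bound: "norm ((\<Sum>i\<in>F. A (coord_proj i f)) - A f) \<le> B * sqrt (infsum h I - sum h F)"
    if F: "finite F" "F \<subseteq> I" for F
  proof -
    \<comment> \<open>The restriction agrees with \<open>f\<close> on \<open>F\<close>, so the
      squared error is the tail of \<open>h\<close> outside \<open>F\<close>.\<close>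
    have "(\<Sum>\<^sub>\<infinity>i\<in>I. (norm (f i - ?r F i))\<^sup>2) = infsum h (I - F)"
      by (rule infsum_cong_neutral) (auto simp: h_def)
    also have "\<dots> = infsum h I - infsum h F"
      using F h by (intro infsum_Diff) auto
    finally have "sum_norm I (f - ?r F) = sqrt (infsum h I - sum h F)"
      using F by (simp add: sum_norm_def)
    then show ?thesis
      unfolding sum[OF F(1)] using B(2)[OF K_diff[OF f K_restrict[OF f, of F]]]
      by (simp add: operatorsD(2)[OF A f K_restrict[OF f]] norm_minus_commute)
  qed
  have "((\<lambda>F. B * sqrt (infsum h I - sum h F)) \<longlongrightarrow> B * sqrt (infsum h I - infsum h I)) (finite_subsets_at_top I)"
    by (intro tendsto_intros infsum_tendsto h)
  then have "((\<lambda>F. (\<Sum>i\<in>F. A (coord_proj i f)) - A f) \<longlongrightarrow> 0) (finite_subsets_at_top I)"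
    by (intro Lim_null_comparison[OF eventually_finite_subsets_at_top_weakI[OF bound]]) auto
  then show ?thesis
    unfolding has_sum_def by (simp add: LIM_zero_iff)
qed

end

section \<open>Synthesis and analysis\<close>

locale bessel_fusion = subspace_family smul ip I W
  for smul :: "'k::hilbert_scalar \<Rightarrow> 'h::{banach,second_countable_topology} \<Rightarrow> 'h" and ip
    and I :: "'i set" and W +
  fixes w :: "'i \<Rightarrow> real" and \<beta> :: real
  assumes beta_pos: "0 < \<beta>"
    and summable_proj: "(\<lambda>i. (w i)\<^sup>2 * (norm (orth_proj ip (W i) x))\<^sup>2) summable_on I"
    and upper_bound: "(\<Sum>\<^sub>\<infinity>i\<in>I. (w i)\<^sup>2 * (norm (orth_proj ip (W i) x))\<^sup>2) \<le> \<beta> * (norm x)\<^sup>2"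
begin

abbreviation "T \<equiv> synthesis I w"
abbreviation "Tadj \<equiv> analysis ip I W w"
abbreviation "S \<equiv> frame_operator ip I W w"
abbreviation "energy x \<equiv> (\<Sum>\<^sub>\<infinity>i\<in>I. (w i)\<^sup>2 * (norm (orth_proj ip (W i) x))\<^sup>2)"

lemma energy_nonneg: "0 \<le> energy x"
  by (simp add: infsum_nonneg)

text \<open>As \<open>f i\<close> lies in \<open>W i\<close>, the projection can be inserted into
  the other slot and the weight moved there with it. Cauchy-Schwarz in each coordinate and then for
  the finite sum finishes.\<close>

lemma finite_ip_bound:
  assumes F: "finite F" "F \<subseteq> I" and f: "\<And>i. i \<in> F \<Longrightarrow> f i \<in> W i"
  shows "norm (ip (\<Sum>i\<in>F. w i *\<^sub>R f i) x) \<le> sqrt (\<Sum>i\<in>F. (norm (f i))\<^sup>2) * sqrt (energy x)"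
proof -
  have "ip (w i *\<^sub>R f i) x = ip (f i) (w i *\<^sub>R orth_proj ip (W i) x)" if "i \<in> F" for i
  proof -
    have "i \<in> I" using that F by blast
    then show ?thesis
      by (simp add: ip_scaleR_left ip_scaleR_right ip_orth_proj(2)[OF subspace_W closed_W f[OF that]])
  qed
  then have "norm (ip (\<Sum>i\<in>F. w i *\<^sub>R f i) x) = norm (\<Sum>i\<in>F. ip (f i) (w i *\<^sub>R orth_proj ip (W i) x))"
    by (simp add: ip_sum_left)
  also have "\<dots> \<le> (\<Sum>i\<in>F. \<bar>norm (f i)\<bar> * \<bar>w i * norm (orth_proj ip (W i) x)\<bar>)"
  proof (rule sum_norm_le)
    fix i
    show "norm (ip (f i) (w i *\<^sub>R orth_proj ip (W i) x)) \<le> \<bar>norm (f i)\<bar> * \<bar>w i * norm (orth_proj ip (W i) x)\<bar>"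
      using cauchy_schwarz[of "f i" "w i *\<^sub>R orth_proj ip (W i) x"] by (simp add: abs_mult)
  qed
  also have "\<dots> \<le> L2_set (\<lambda>i. norm (f i)) F * L2_set (\<lambda>i. w i * norm (orth_proj ip (W i) x)) F"
    by (rule L2_set_mult_ineq)
  also have "\<dots> \<le> sqrt (\<Sum>i\<in>F. (norm (f i))\<^sup>2) * sqrt (energy x)"
    unfolding L2_set_def power_mult_distrib
    by (intro mult_left_mono real_sqrt_le_mono finite_sum_le_infsum summable_proj F) (auto simp: sum_nonneg)
  finally show ?thesis .
qed

text \<open>Take \<open>x\<close> in \<open>finite_ip_bound\<close> to be the finite sum itself,
  bound its energy by \<open>\<beta>\<close>, and cancel one factor of its norm.\<close>

lemma finite_synthesis_bound:
  assumes F: "finite F" "F \<subseteq> I" and f: "\<And>i. i \<in> F \<Longrightarrow> f i \<in> W i"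
  shows "(norm (\<Sum>i\<in>F. w i *\<^sub>R f i))\<^sup>2 \<le> \<beta> * (\<Sum>i\<in>F. (norm (f i))\<^sup>2)"
proof -
  let ?h = "\<Sum>i\<in>F. w i *\<^sub>R f i" and ?s = "\<Sum>i\<in>F. (norm (f i))\<^sup>2"
  have s0: "0 \<le> ?s" by (simp add: sum_nonneg)
  have "(norm ?h)\<^sup>2 = norm (ip ?h ?h)"
    by (simp add: ip_self norm_power)
  also have "\<dots> \<le> sqrt ?s * sqrt (energy ?h)"
    by (rule finite_ip_bound[OF assms])
  also have "\<dots> \<le> sqrt ?s * sqrt (\<beta> * (norm ?h)\<^sup>2)"
    by (intro mult_left_mono real_sqrt_le_mono upper_bound) (simp add: s0)
  also have "\<dots> = sqrt (\<beta> * ?s) * norm ?h"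
    by (simp add: real_sqrt_mult)
  finally have "norm ?h * norm ?h \<le> sqrt (\<beta> * ?s) * norm ?h"
    by (simp add: power2_eq_square)
  then have "norm ?h \<le> sqrt (\<beta> * ?s)"
    using s0 beta_pos by (cases "?h = 0") auto
  then show ?thesis
    using s0 beta_pos power_mono[of "norm ?h" "sqrt (\<beta> * ?s)" 2] by simp
qed

text \<open>The estimate \<open>finite_synthesis_bound\<close> is the domination hypothesis of
  \<open>dominated_summable\<close> with the squared norms \<open>(norm (f i))\<^sup>2\<close> and
  \<open>C = \<beta>\<close>, which gives both convergence and the operator bound.\<close>

lemma
  assumes f: "f \<in> K"
  shows synthesis_has_sum: "((\<lambda>i. w i *\<^sub>R f i) has_sum T f) I"
    and norm_synthesis_le: "norm (T f) \<le> sqrt \<beta> * sum_norm I f"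
proof -
  have fW: "f i \<in> W i" if "i \<in> I" for i
    using f that by (simp add: direct_sum_def)
  have "(\<lambda>i. (norm (f i))\<^sup>2) summable_on I"
    using f by (simp add: direct_sum_def)
  note dom = dominated_summable[OF this _ less_imp_le[OF beta_pos], of "\<lambda>i. w i *\<^sub>R f i"]
  show "((\<lambda>i. w i *\<^sub>R f i) has_sum T f) I"
    unfolding synthesis_def by (intro has_sum_infsum dom finite_synthesis_bound) (use fW in auto)
  have "(norm (T f))\<^sup>2 \<le> \<beta> * (\<Sum>\<^sub>\<infinity>i\<in>I. (norm (f i))\<^sup>2)"
    unfolding synthesis_def by (intro dom finite_synthesis_bound) (use fW in auto)
  also have "\<dots> = (sqrt \<beta> * sum_norm I f)\<^sup>2"
    using beta_pos by (simp add: power_mult_distrib sum_norm_square)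
  finally show "norm (T f) \<le> sqrt \<beta> * sum_norm I f"
    using beta_pos by (intro power2_le_imp_le[OF _ mult_nonneg_nonneg]) auto
qed

text \<open>The limit of \<open>finite_ip_bound\<close> over finite index sets. The energy of
  \<open>x\<close> is kept instead of its upper bound, since this is how a lower frame bound for a
  dual is obtained later.\<close>

lemma ip_synthesis_bound:
  assumes f: "f \<in> K"
  shows "norm (ip (T f) x) \<le> sum_norm I f * sqrt (energy x)"
proof (rule tendsto_upperbound[OF _ _ finite_subsets_at_top_neq_bot])
  have "(sum (\<lambda>i. w i *\<^sub>R f i) \<longlongrightarrow> T f) (finite_subsets_at_top I)"
    using synthesis_has_sum[OF f] by (simp add: has_sum_def)
  then show "((\<lambda>F. norm (ip (\<Sum>i\<in>F. w i *\<^sub>R f i) x)) \<longlongrightarrow> norm (ip (T f) x)) (finite_subsets_at_top I)"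
    by (intro tendsto_norm bounded_linear.tendsto[OF bounded_linear_ip_left])
  have "norm (ip (\<Sum>i\<in>F. w i *\<^sub>R f i) x) \<le> sum_norm I f * sqrt (energy x)" if F: "finite F" "F \<subseteq> I" for F
  proof -
    have "norm (ip (\<Sum>i\<in>F. w i *\<^sub>R f i) x) \<le> sqrt (\<Sum>i\<in>F. (norm (f i))\<^sup>2) * sqrt (energy x)"
      using F f by (intro finite_ip_bound) (auto simp: direct_sum_def)
    also have "\<dots> \<le> sum_norm I f * sqrt (energy x)"
      unfolding sum_norm_def using F f
      by (intro mult_right_mono real_sqrt_le_mono finite_sum_le_infsum) (auto simp: direct_sum_def energy_nonneg)
    finally show ?thesis .
  qed
  then show "\<forall>\<^sub>F F in finite_subsets_at_top I. norm (ip (\<Sum>i\<in>F. w i *\<^sub>R f i) x) \<le> sum_norm I f * sqrt (energy x)"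
    by (rule eventually_finite_subsets_at_top_weakI)
qed

lemma synthesis_operator: "T \<in> operators"
proof -
  have "T (f + g) = T f + T g" if "f \<in> K" "g \<in> K" for f g
    using has_sum_add[OF synthesis_has_sum[OF that(1)] synthesis_has_sum[OF that(2)]]
      synthesis_has_sum[OF K_add[OF that]] by (simp add: scaleR_add_right has_sum_unique)
  moreover have "T (sum_scale smul c f) = smul c (T f)" if "f \<in> K" for c f
    using has_sum_bounded_linear[OF bounded_linear_smul synthesis_has_sum[OF that], of c]
      synthesis_has_sum[OF K_scale[OF that], of c]
    by (simp add: linear_simps(5)[OF bounded_linear_smul] sum_scale_def has_sum_unique)
  ultimately show ?thesis
    using norm_synthesis_le unfolding bounded_operators_def by blast
qed

lemma synthesis_coord_proj: assumes "i \<in> I" shows "T (coord_proj i f) = w i *\<^sub>R f i"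
proof -
  have "(\<Sum>\<^sub>\<infinity>j\<in>I. w j *\<^sub>R coord_proj i f j) = (\<Sum>\<^sub>\<infinity>j\<in>{i}. w j *\<^sub>R f j)"
    using assms by (intro infsum_cong_neutral) (auto simp: coord_proj_def)
  then show ?thesis by (simp add: synthesis_def)
qed

section \<open>The analysis operator and the frame operator\<close>

lemma sum_norm_analysis: "sum_norm I (Tadj x) = sqrt (energy x)"
  unfolding sum_norm_def analysis_def
  by (intro arg_cong[where f = sqrt] infsum_cong) (simp add: power_mult_distrib)

lemma analysis_in: "Tadj x \<in> K"
proof -
  have "(\<lambda>i. (norm (Tadj x i))\<^sup>2) summable_on I \<longleftrightarrow> (\<lambda>i. (w i)\<^sup>2 * (norm (orth_proj ip (W i) x))\<^sup>2) summable_on I"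
    by (rule summable_on_cong) (simp add: analysis_def power_mult_distrib)
  then show ?thesis
    using summable_proj by (auto simp: direct_sum_def analysis_def subspace_scaleR orth_proj_in subspace_W closed_W)
qed

lemma sum_norm_analysis_le: "sum_norm I (Tadj x) \<le> sqrt \<beta> * norm x"
  using real_sqrt_le_mono[OF upper_bound, of x] by (simp add: sum_norm_analysis real_sqrt_mult)

lemma analysis_add: "Tadj (x + y) = Tadj x + Tadj y"
  by (auto simp: analysis_def orth_proj_add subspace_W closed_W scaleR_add_right)

lemma analysis_scale: "Tadj (smul c x) = sum_scale smul c (Tadj x)"
  by (auto simp: analysis_def sum_scale_def orth_proj_smul subspace_W closed_W linear_simps(5)[OF bounded_linear_smul])

lemma frame_operator_add: "S (x + y) = S x + S y"
  unfolding frame_operator_def analysis_add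
  by (intro operatorsD(1)[OF synthesis_operator] analysis_in)

lemma frame_operator_scale: "S (smul c x) = smul c (S x)"
  unfolding frame_operator_def analysis_scale
  by (intro operatorsD(3)[OF synthesis_operator] analysis_in)

lemma frame_operator_diff: "S (x - y) = S x - S y"
  using frame_operator_add[of "x - y" y] by simp

lemma norm_frame_operator_le: "norm (S x) \<le> \<beta> * norm x"
proof -
  have "norm (S x) \<le> sqrt \<beta> * sum_norm I (Tadj x)"
    unfolding frame_operator_def by (intro norm_synthesis_le analysis_in)
  also have "\<dots> \<le> sqrt \<beta> * (sqrt \<beta> * norm x)"
    using beta_pos by (intro mult_left_mono sum_norm_analysis_le) auto
  finally show ?thesis using beta_pos by (simp flip: mult.assoc)
qed

text \<open>Each term reduces to \<open>ip p x = ip p p\<close> for a projection \<open>p\<close> of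
  \<open>x\<close>. The identity turns frame bounds into bounds on \<open>S\<close>.\<close>

lemma ip_frame_operator: "ip (S x) x = of_real (energy x)"
proof -
  have "((\<lambda>i. w i *\<^sub>R Tadj x i) has_sum S x) I"
    unfolding frame_operator_def by (intro synthesis_has_sum analysis_in)
  then have "((\<lambda>i. ip (w i *\<^sub>R Tadj x i) x) has_sum ip (S x) x) I"
    by (rule has_sum_bounded_linear[OF bounded_linear_ip_left])
  moreover have "ip (w i *\<^sub>R Tadj x i) x = of_real ((w i)\<^sup>2 * (norm (orth_proj ip (W i) x))\<^sup>2)" if "i \<in> I" for i
  proof -
    let ?p = "orth_proj ip (W i) x"
    have "ip ?p x = ip ?p ?p"
      using that by (intro ip_orth_proj(2)[symmetric] orth_proj_in subspace_W closed_W)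
    then show ?thesis
      using that by (simp add: analysis_def ip_scaleR_left ip_self power2_eq_square mult.assoc)
  qed
  ultimately have "((\<lambda>i. of_real ((w i)\<^sup>2 * (norm (orth_proj ip (W i) x))\<^sup>2)) has_sum ip (S x) x) I"
    by (subst (asm) has_sum_cong) auto
  \<comment> \<open>The real energy series is carried into \<open>'k\<close> by the bounded linear
    map \<open>of_real\<close>; uniqueness of sums then identifies the two values.\<close>
  moreover have "((\<lambda>i. of_real ((w i)\<^sup>2 * (norm (orth_proj ip (W i) x))\<^sup>2) :: 'k) has_sum of_real (energy x)) I"
    by (intro has_sum_bounded_linear[OF bounded_linear_of_real] has_sum_infsum summable_proj)
  ultimately show ?thesis by (rule has_sum_unique)
qed

end

section \<open>The fusion frame operator and left inverses of the analysis operator\<close>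

locale fusion = bessel_fusion smul ip I W w \<beta>
  for smul :: "'k::hilbert_scalar \<Rightarrow> 'h::{banach,second_countable_topology} \<Rightarrow> 'h" and ip
    and I :: "'i set" and W w \<beta> +
  fixes \<alpha> :: real
  assumes alpha_pos: "0 < \<alpha>"
    and lower_bound: "\<alpha> * (norm x)\<^sup>2 \<le> energy x"
begin

text \<open>The lower frame bound on \<open>ip (S x) x\<close> combined with Cauchy-Schwarz. It
  yields injectivity of \<open>S\<close> and the bound \<open>1 / \<alpha>\<close> for the
  inverse.\<close>

lemma norm_frame_operator_ge: "\<alpha> * norm x \<le> norm (S x)"
proof (cases "x = 0")
  case False
  have "\<alpha> * (norm x)\<^sup>2 \<le> norm (ip (S x) x)"
    using lower_bound[of x] by (simp add: ip_frame_operator)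
  also have "\<dots> \<le> norm (S x) * norm x"
    by (rule cauchy_schwarz)
  finally show ?thesis
    using False by (simp add: power2_eq_square)
qed simp

text \<open>For \<open>t = \<alpha> / \<beta>\<^sup>2\<close> the map \<open>x \<mapsto> x - t (S x - y)\<close> is a contraction, whose fixed point solves \<open>S x = y\<close>.\<close>

lemma frame_operator_relaxation:
  "(norm (x - (\<alpha> / \<beta>\<^sup>2) *\<^sub>R S x))\<^sup>2 \<le> (1 - \<alpha>\<^sup>2 / \<beta>\<^sup>2) * (norm x)\<^sup>2"
proof -
  let ?t = "\<alpha> / \<beta>\<^sup>2"
  have t: "0 < ?t" using alpha_pos beta_pos by simp
  have 1: "ip (?t *\<^sub>R S x) x = of_real (?t * energy x)"
    by (simp add: ip_scaleR_left ip_frame_operator)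
  have 2: "ip x (?t *\<^sub>R S x) = of_real (?t * energy x)"
    unfolding ip_commute[of x "?t *\<^sub>R S x"] 1 by (rule kconj_of_real)
  have "(of_real ((norm (x - ?t *\<^sub>R S x))\<^sup>2) :: 'k) =
      of_real ((norm x)\<^sup>2 + (norm (?t *\<^sub>R S x))\<^sup>2 - (?t * energy x + ?t * energy x))"
    by (simp only: norm_diff_square 1 2 of_real_add of_real_diff)
  then have "(norm (x - ?t *\<^sub>R S x))\<^sup>2 = (norm x)\<^sup>2 + (norm (?t *\<^sub>R S x))\<^sup>2 - (?t * energy x + ?t * energy x)"
    by (simp only: of_real_eq_iff)
  \<comment> \<open>The resulting factor
    \<open>1 - 2 * t * \<alpha> + t\<^sup>2 * \<beta>\<^sup>2\<close> is smallest at
    \<open>t = \<alpha> / \<beta>\<^sup>2\<close>, where it equals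
    \<open>1 - \<alpha>\<^sup>2 / \<beta>\<^sup>2\<close>.\<close>
  also have "\<dots> \<le> (norm x)\<^sup>2 + (?t * (\<beta> * norm x))\<^sup>2 - (?t * (\<alpha> * (norm x)\<^sup>2) + ?t * (\<alpha> * (norm x)\<^sup>2))"
  proof (intro diff_mono add_mono power_mono order_refl mult_left_mono lower_bound)
    show "norm (?t *\<^sub>R S x) \<le> ?t * (\<beta> * norm x)"
      unfolding norm_scaleR abs_of_pos[OF t] using t by (intro mult_left_mono norm_frame_operator_le) simp
  qed (use t in auto)
  also have "\<dots> = (1 - \<alpha>\<^sup>2 / \<beta>\<^sup>2) * (norm x)\<^sup>2"
    using beta_pos by (simp add: field_simps power2_eq_square)
  finally show ?thesis .
qed

text \<open>Injectivity holds because \<open>S\<close> is bounded below; surjectivity is Banach's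
  fixed point theorem applied to the relaxed iteration.\<close>

lemma bij_frame_operator: "bij S"
proof (rule bijI)
  show "inj S"
  proof (rule injI)
    fix x y assume "S x = S y"
    then have "\<alpha> * norm (x - y) \<le> 0"
      using norm_frame_operator_ge[of "x - y"] by (simp add: frame_operator_diff)
    then show "x = y" using alpha_pos by (simp add: mult_le_0_iff)
  qed
  show "surj S"
    unfolding surj_def
  proof
    fix y
    let ?t = "\<alpha> / \<beta>\<^sup>2"
    \<comment> \<open>In the zero space the two bounds do not force
      \<open>\<alpha> \<le> \<beta>\<close>; the maximum keeps the radicand nonnegative there
      too.\<close>
    define c where "c = sqrt (max 0 (1 - \<alpha>\<^sup>2 / \<beta>\<^sup>2))"
    have c: "0 \<le> c" "c < 1"
      using alpha_pos beta_pos by (auto simp: c_def)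
    have "dist (x - ?t *\<^sub>R (S x - y)) (z - ?t *\<^sub>R (S z - y)) \<le> c * dist x z" for x z
    proof -
      have "(x - ?t *\<^sub>R (S x - y)) - (z - ?t *\<^sub>R (S z - y)) = (x - z) - ?t *\<^sub>R S (x - z)"
        by (simp add: frame_operator_diff scaleR_diff_right)
      then have "dist (x - ?t *\<^sub>R (S x - y)) (z - ?t *\<^sub>R (S z - y)) = norm ((x - z) - ?t *\<^sub>R S (x - z))"
        by (simp only: dist_norm)
      moreover have "(norm ((x - z) - ?t *\<^sub>R S (x - z)))\<^sup>2 \<le> (c * norm (x - z))\<^sup>2"
      proof -
        have "(norm ((x - z) - ?t *\<^sub>R S (x - z)))\<^sup>2 \<le> max 0 (1 - \<alpha>\<^sup>2 / \<beta>\<^sup>2) * (norm (x - z))\<^sup>2"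
          by (rule order_trans[OF frame_operator_relaxation mult_right_mono]) simp_all
        then show ?thesis by (simp add: c_def power_mult_distrib)
      qed
      then have "norm ((x - z) - ?t *\<^sub>R S (x - z)) \<le> c * norm (x - z)"
        by (rule power2_le_imp_le) (simp add: c)
      ultimately show ?thesis by (simp add: dist_norm)
    qed
    then have "\<exists>!x. x - ?t *\<^sub>R (S x - y) = x"
      by (intro banach_fix_type[OF c] allI)
    then obtain x where "x - ?t *\<^sub>R (S x - y) = x"
      by (elim ex1E)
    then have "S x = y"
      using alpha_pos beta_pos by simp
    then show "\<exists>x. y = S x" by blast
  qed
qed

section \<open>The inverse frame operator and left inverses of the analysis operator\<close>

abbreviation "Sinv \<equiv> inv S"

lemma frame_operator_inverse [simp]: "S (Sinv y) = y" "Sinv (S x) = x"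
  using bij_frame_operator by (simp_all add: bij_is_surj surj_f_inv_f bij_is_inj inv_f_f)

lemma Sinv_add: "Sinv (x + y) = Sinv x + Sinv y"
  by (metis frame_operator_add frame_operator_inverse)

lemma Sinv_scale: "Sinv (smul c x) = smul c (Sinv x)"
  by (metis frame_operator_scale frame_operator_inverse)

lemma norm_Sinv_le: "norm (Sinv y) \<le> norm y / \<alpha>"
  using norm_frame_operator_ge[of "Sinv y"] alpha_pos by (simp add: field_simps)

text \<open>The argument of \<open>R\<close> is the orthogonal projection of \<open>f\<close> onto
  the kernel of \<open>T\<close>, so only the values of \<open>R\<close> on that kernel
  matter.\<close>

abbreviation left_inverse :: "(('i \<Rightarrow> 'h) \<Rightarrow> 'h) \<Rightarrow> ('i \<Rightarrow> 'h) \<Rightarrow> 'h" where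
  "left_inverse R f \<equiv> Sinv (T f) + R (f - Tadj (Sinv (T f)))"

lemma left_inverse_operator:
  assumes R: "R \<in> operators"
  shows "left_inverse R \<in> operators"
proof -
  note T = operatorsD[OF synthesis_operator] and RD = operatorsD[OF R]
  obtain B where B: "0 < B" "\<And>f. f \<in> K \<Longrightarrow> norm (R f) \<le> B * sum_norm I f"
    using R by (rule bounded_operatorsE) simp_all
  have "left_inverse R (f + g) = left_inverse R f + left_inverse R g" if "f \<in> K" "g \<in> K" for f g
    using that by (simp add: T RD Sinv_add analysis_add analysis_in K_add algebra_simps)
  moreover have "left_inverse R (sum_scale smul c f) = smul c (left_inverse R f)" if "f \<in> K" for c f
    using that
    by (simp add: T RD Sinv_scale analysis_scale analysis_in K_scale scale_right_distrib scale_right_diff_distrib)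
  \<comment> \<open>The constant adds the bounds of the three terms, built from
    \<open>sqrt \<beta>\<close> for \<open>T\<close> and \<open>Tadj\<close>,
    \<open>1 / \<alpha>\<close> for \<open>Sinv\<close> and \<open>B\<close> for
    \<open>R\<close>.\<close>
  moreover have "norm (left_inverse R f) \<le> (sqrt \<beta> / \<alpha> + (B + B * (sqrt \<beta> * (sqrt \<beta> / \<alpha>)))) * sum_norm I f"
    if f: "f \<in> K" for f
  proof -
    let ?s = "Sinv (T f)"
    have s: "norm ?s \<le> sqrt \<beta> / \<alpha> * sum_norm I f"
      using order_trans[OF norm_Sinv_le divide_right_mono[OF norm_synthesis_le[OF f]]] alpha_pos by simp
    have "norm (R (Tadj ?s)) \<le> B * sum_norm I (Tadj ?s)"
      by (rule B(2)[OF analysis_in])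
    also have "\<dots> \<le> B * (sqrt \<beta> * norm ?s)"
      using B(1) by (intro mult_left_mono sum_norm_analysis_le) simp
    also have "\<dots> \<le> B * (sqrt \<beta> * (sqrt \<beta> / \<alpha> * sum_norm I f))"
      using B(1) beta_pos s by (intro mult_left_mono) auto
    finally have "norm (R (Tadj ?s)) \<le> B * (sqrt \<beta> * (sqrt \<beta> / \<alpha> * sum_norm I f))" .
    moreover have "norm (left_inverse R f) \<le> norm ?s + (norm (R f) + norm (R (Tadj ?s)))"
      unfolding RD(2)[OF f analysis_in] by (intro norm_triangle_le add_left_mono norm_triangle_ineq4)
    ultimately have "norm (left_inverse R f) \<le> sqrt \<beta> / \<alpha> * sum_norm I f +
        (B * sum_norm I f + B * (sqrt \<beta> * (sqrt \<beta> / \<alpha> * sum_norm I f)))"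
      using s B(2)[OF f] by linarith
    then show ?thesis by (simp only: distrib_right mult.assoc)
  qed
  ultimately show ?thesis
    unfolding bounded_operators_def by blast
qed

text \<open>On the range of \<open>Tadj\<close> the first summand is \<open>Sinv (S x)\<close> and
  the argument of \<open>R\<close> vanishes.\<close>

lemma left_inverse_analysis:
  assumes "R \<in> operators"
  shows "left_inverse R (Tadj x) = x"
  using operatorsD(4)[OF assms] by (simp add: frame_operator_def[symmetric])

text \<open>With \<open>s = Sinv (T f)\<close>, linearity gives
  \<open>A (f - Tadj s) = A f - s\<close>, and the first summand \<open>s\<close> cancels. So each
  bounded left inverse of \<open>Tadj\<close> is its own parameter \<open>R\<close>.\<close>

lemma left_inverse_fixed:
  assumes A: "A \<in> operators" "\<And>x. A (Tadj x) = x" and f: "f \<in> K"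
  shows "left_inverse A f = A f"
  by (simp add: operatorsD(2)[OF A(1) f analysis_in] A(2))

end

section \<open>Component preserving duals\<close>

text \<open>Scaling by a nonzero number maps a subspace onto itself. With \<open>c = v i\<close>
  this absorbs the weight that synthesis puts on a single component.\<close>

lemma (in subspace_family) image_coord_proj_scaled:
  assumes i: "i \<in> I" and c: "c \<noteq> 0"
  shows "(\<lambda>f. c *\<^sub>R f i) ` coord_proj i ` K = W i"
proof -
  have "(\<lambda>x. c *\<^sub>R x) ` W i = W i"
  proof (intro equalityI subsetI)
    fix x assume x: "x \<in> W i"
    then have "x = c *\<^sub>R (inverse c *\<^sub>R x)" "inverse c *\<^sub>R x \<in> W i"
      using c i by (auto intro: subspace_scaleR subspace_W)
    then show "x \<in> (\<lambda>x. c *\<^sub>R x) ` W i" by blast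
  qed (use i in \<open>auto intro: subspace_scaleR subspace_W\<close>)
  then show ?thesis
    by (simp add: coord_proj_image[OF i] image_image) (simp add: coord_proj_def)
qed

text \<open>Dividing by \<open>v i\<close> cancels the weight that synthesis multiplies back; the
  value 0 outside \<open>I\<close> is required for membership in a direct sum.\<close>

definition rescaled_components ::
  "'i set \<Rightarrow> ('i \<Rightarrow> real) \<Rightarrow> (('i \<Rightarrow> 'h::real_normed_vector) \<Rightarrow> 'h) \<Rightarrow> ('i \<Rightarrow> 'h) \<Rightarrow> 'i \<Rightarrow> 'h" where
  "rescaled_components I v A f = (\<lambda>i. if i \<in> I then inverse (v i) *\<^sub>R A (coord_proj i f) else 0)"

text \<open>\<open>V\<close> is assumed only Bessel, so that both directions of the equivalence can
  work here: in the converse direction its lower bound is a conclusion.\<close>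

locale fusion_pair = W: fusion smul ip I W w \<beta> \<alpha> + V: bessel_fusion smul ip I V v \<gamma>
  for smul :: "'k::hilbert_scalar \<Rightarrow> 'h::{banach,second_countable_topology} \<Rightarrow> 'h" and ip
    and I :: "'i set" and W w \<beta> \<alpha> V v \<gamma> +
  fixes \<delta> :: real
  assumes delta_pos: "0 < \<delta>" and delta_less: "i \<in> I \<Longrightarrow> \<delta> < v i"
begin

abbreviation "operators_WV \<equiv> bounded_operators (sum_scale smul) (sum_norm I) (direct_sum I W)
                              (sum_scale smul) (sum_norm I) (direct_sum I V)"

lemma synthesis_comp_operator:
  assumes Q: "Q \<in> operators_WV"
  shows "(\<lambda>f. synthesis I v (Q f)) \<in> W.operators"
proof -
  have QV: "Q f \<in> V.K" if "f \<in> W.K" for f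
    using Q that by (simp add: bounded_operators_def)
  obtain B where B: "0 < B" "\<And>f. f \<in> W.K \<Longrightarrow> sum_norm I (Q f) \<le> B * sum_norm I f"
    using Q by (rule bounded_operatorsE) simp_all
  have "norm (synthesis I v (Q f)) \<le> sqrt \<gamma> * B * sum_norm I f" if "f \<in> W.K" for f
    using V.norm_synthesis_le[OF QV[OF that]] B(2)[OF that] V.beta_pos
    by (smt (verit) mult.assoc mult_left_mono real_sqrt_gt_0_iff)
  then show ?thesis
    using Q QV V.operatorsD(1,3)[OF V.synthesis_operator] unfolding bounded_operators_def by auto
qed

lemma lower_bound_of_dual:
  assumes Q: "Q \<in> operators_WV" and dual: "\<And>x. synthesis I v (Q (W.Tadj x)) = x"
  shows "\<exists>c>0. \<forall>x. c * (norm x)\<^sup>2 \<le> V.energy x"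
proof -
  obtain B where B: "0 < B" "\<And>f. f \<in> W.K \<Longrightarrow> sum_norm I (Q f) \<le> B * sum_norm I f"
    using Q by (rule bounded_operatorsE) simp_all
  \<comment> \<open>\<open>B * sqrt \<beta>\<close> bounds \<open>Q\<close> after
    \<open>W.Tadj\<close>; the inverse of its square becomes the lower frame bound.\<close>
  have M: "0 < B * sqrt \<beta>" using B(1) W.beta_pos by simp
  have "(norm x)\<^sup>2 \<le> (B * sqrt \<beta>)\<^sup>2 * V.energy x" for x
  proof -
    let ?g = "Q (W.Tadj x)"
    have "?g \<in> V.K"
      using Q W.analysis_in by (simp add: bounded_operators_def)
    then have "(norm x)\<^sup>2 \<le> sum_norm I ?g * sqrt (V.energy x)"
      using V.ip_synthesis_bound[of ?g x] by (simp add: dual W.ip_self norm_power)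
    also have "\<dots> \<le> (B * (sqrt \<beta> * norm x)) * sqrt (V.energy x)"
      using B(2)[OF W.analysis_in[of x]] W.sum_norm_analysis_le[of x] B(1)
      by (intro mult_right_mono order_trans[OF B(2)[OF W.analysis_in]] mult_left_mono)
        (auto simp: V.energy_nonneg)
    finally have "norm x \<le> (B * sqrt \<beta>) * sqrt (V.energy x)"
      using M V.energy_nonneg[of x] by (cases "x = 0") (auto simp: power2_eq_square)
    then have "(norm x)\<^sup>2 \<le> ((B * sqrt \<beta>) * sqrt (V.energy x))\<^sup>2"
      by (intro power_mono) auto
    then show ?thesis
      by (simp only: power_mult_distrib real_sqrt_pow2[OF V.energy_nonneg])
  qed
  then have "1 / (B * sqrt \<beta>)\<^sup>2 * (norm x)\<^sup>2 \<le> V.energy x" for x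
    unfolding times_divide_eq_left mult_1_left pos_divide_le_eq[OF zero_less_power[OF M]]
    by (simp only: mult.commute)
  then show ?thesis
    using zero_less_power[OF M, of 2] by (intro exI[of _ "1 / (B * sqrt \<beta>)\<^sup>2"] conjI allI) simp
qed

text \<open>On a single coordinate \<open>A\<close> is bounded by \<open>B * norm (f i)\<close>, and
  inverse weights are at most \<open>1 / \<delta>\<close>, so the components are dominated with
  constant \<open>B / \<delta>\<close>. The hypothesis on \<open>V\<close> places them in
  \<open>V i\<close> and makes each coordinate image all of \<open>V i\<close>.\<close>

lemma
  assumes A: "A \<in> W.operators" and V: "\<And>i. i \<in> I \<Longrightarrow> V i = A ` coord_proj i ` W.K"
  shows rescaled_operator: "rescaled_components I v A \<in> operators_WV"
    and synthesis_rescaled: "\<And>f. f \<in> W.K \<Longrightarrow> synthesis I v (rescaled_components I v A f) = A f"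
    and rescaled_image: "\<And>i. i \<in> I \<Longrightarrow>
      rescaled_components I v A ` coord_proj i ` W.K = coord_proj i ` V.K"
proof -
  let ?Q = "rescaled_components I v A"
  note AD = W.operatorsD[OF A]
  obtain B where B: "0 < B" "\<And>f. f \<in> W.K \<Longrightarrow> norm (A f) \<le> B * sum_norm I f"
    using A by (rule bounded_operatorsE) simp_all
  have v: "0 < v i" if "i \<in> I" for i
    using delta_less[OF that] delta_pos by simp
  have inV: "r *\<^sub>R A (coord_proj i f) \<in> V i" if "i \<in> I" "f \<in> W.K" for i f r
    using that V[of i] by (intro W.subspace_scaleR V.subspace_W) auto
  have le: "norm (?Q f i) \<le> (B / \<delta>) * norm (f i)" if "i \<in> I" "f \<in> W.K" for i f
  proof -
    have "norm (A (coord_proj i f)) \<le> B * norm (f i)"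
      using B(2)[OF W.K_coord_proj[OF that(2), of i]] that(1) by (simp add: W.sum_norm_coord_proj)
    moreover have "inverse (v i) \<le> inverse \<delta>"
      using delta_less[OF that(1)] delta_pos by simp
    ultimately have "inverse (v i) * norm (A (coord_proj i f)) \<le> inverse \<delta> * (B * norm (f i))"
      using delta_pos by (intro mult_mono) auto
    then show ?thesis
      using that v[OF that(1)] by (simp add: rescaled_components_def field_simps)
  qed
  have dom: "?Q f \<in> V.K \<and> sum_norm I (?Q f) \<le> (B / \<delta>) * sum_norm I f" if "f \<in> W.K" for f
  proof -
    have "?Q f i \<in> V i" if "i \<in> I" for i
      using inV[OF that \<open>f \<in> W.K\<close>] that by (simp add: rescaled_components_def)
    moreover have "?Q f i = 0" if "i \<notin> I" for i
      using that by (simp add: rescaled_components_def)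
    ultimately show ?thesis
      using direct_sum_dominated[OF that, of "B / \<delta>" "?Q f" V] le[OF _ that] B(1) delta_pos by simp
  qed
  have "?Q (f + g) = ?Q f + ?Q g" if "f \<in> W.K" "g \<in> W.K" for f g
  proof -
    have "coord_proj i (f + g) = coord_proj i f + coord_proj i g" for i
      by (auto simp: coord_proj_def)
    then show ?thesis
      using that by (auto simp: rescaled_components_def AD W.K_coord_proj scaleR_add_right)
  qed
  moreover have "?Q (sum_scale smul c f) = sum_scale smul c (?Q f)" if "f \<in> W.K" for c f
  proof -
    have "A (coord_proj i (sum_scale smul c f)) = smul c (A (coord_proj i f))" for i
    proof -
      have "coord_proj i (sum_scale smul c f) = sum_scale smul c (coord_proj i f)"
        by (auto simp: coord_proj_def sum_scale_def)
      then show ?thesis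
        by (simp add: AD(3)[OF W.K_coord_proj[OF that]])
    qed
    then show ?thesis
      unfolding sum_scale_def[of _ _ "?Q f"]
      by (auto simp: rescaled_components_def linear_simps(5)[OF W.bounded_linear_smul])
  qed
  ultimately show "?Q \<in> operators_WV"
    using dom unfolding bounded_operators_def by blast
  show "synthesis I v (?Q f) = A f" if "f \<in> W.K" for f
  proof -
    have "v i *\<^sub>R ?Q f i = A (coord_proj i f)" if "i \<in> I" for i
      using that v[OF that] by (simp add: rescaled_components_def)
    then have "synthesis I v (?Q f) = (\<Sum>\<^sub>\<infinity>i\<in>I. A (coord_proj i f))"
      unfolding synthesis_def by (rule infsum_cong)
    then show ?thesis
      using W.operators_has_sum[OF A that] by (simp add: infsumI)
  qed
  show "?Q ` coord_proj i ` W.K = coord_proj i ` V.K" if i: "i \<in> I" for i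
  proof -
    \<comment> \<open>For \<open>j \<noteq> i\<close> the doubly projected family is zero, and
      \<open>A 0 = 0\<close>; only coordinate \<open>i\<close> survives.\<close>
    have Q: "?Q (coord_proj i f) = coord_proj i (\<lambda>_. inverse (v i) *\<^sub>R A (coord_proj i f))" for f
    proof
      fix j
      have "coord_proj j (coord_proj i f) = (if j = i then coord_proj i f else 0)"
        by (auto simp: coord_proj_def)
      then show "?Q (coord_proj i f) j = coord_proj i (\<lambda>_. inverse (v i) *\<^sub>R A (coord_proj i f)) j"
        using i AD(4) by (cases "j = i")
          (simp_all add: rescaled_components_def coord_proj_def[of i "\<lambda>_. _ *\<^sub>R _"])
    qed
    show ?thesis
      unfolding V.coord_proj_image[OF i]
    proof (intro equalityI subsetI)
      fix g assume "g \<in> ?Q ` coord_proj i ` W.K"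
      then show "g \<in> (\<lambda>x. coord_proj i (\<lambda>_. x)) ` V i"
        using inV[OF i] by (auto simp: Q)
    next
      fix g assume "g \<in> (\<lambda>x. coord_proj i (\<lambda>_. x)) ` V i"
      then obtain x where x: "x \<in> V i" "g = coord_proj i (\<lambda>_. x)" by blast
      \<comment> \<open>To reach \<open>x\<close> after division by \<open>v i\<close>, a preimage
        under \<open>A\<close> is needed for \<open>v i *\<^sub>R x\<close>, which also lies in the
        subspace \<open>V i\<close>.\<close>
      then have "v i *\<^sub>R x \<in> V i"
        using i by (intro W.subspace_scaleR V.subspace_W)
      then obtain f where f: "f \<in> W.K" "v i *\<^sub>R x = A (coord_proj i f)"
        unfolding V[OF i] by blast
      then have "x = inverse (v i) *\<^sub>R A (coord_proj i f)"
        using v[OF i] by (simp flip: f(2))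
      then have "g = ?Q (coord_proj i f)"
        unfolding Q x(2) by simp
      then show "g \<in> ?Q ` coord_proj i ` W.K"
        using f(1) by blast
    qed
  qed
qed

end

section \<open>Frame bounds as explicit constants\<close>

lemma bessel_fusionI:
  assumes "separable_hilbert_space smul ip" "bessel_fusion_sequence smul ip I W w"
  obtains \<beta> where "bessel_fusion smul ip I W w \<beta>"
proof -
  interpret separable_hilbert_space smul ip by fact
  show ?thesis
    using assms(2) that unfolding bessel_fusion_sequence_def weighted_subspaces_def
    by (auto simp: bessel_fusion_def subspace_family_def subspace_family_axioms_def
        bessel_fusion_axioms_def separable_hilbert_space_axioms)
qed

lemma fusion_frame_imp_bessel:
  assumes "fusion_frame smul ip I W w"
  shows "bessel_fusion_sequence smul ip I W w"
proof -
  obtain \<alpha> \<beta> :: real where ab: "0 < \<alpha>" "\<alpha> \<le> \<beta>"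
    and "\<forall>f. (\<lambda>i. (w i)\<^sup>2 * (norm (orth_proj ip (W i) f))\<^sup>2) summable_on I \<and>
          \<alpha> * (norm f)\<^sup>2 \<le> (\<Sum>\<^sub>\<infinity>i\<in>I. (w i)\<^sup>2 * (norm (orth_proj ip (W i) f))\<^sup>2) \<and>
          (\<Sum>\<^sub>\<infinity>i\<in>I. (w i)\<^sup>2 * (norm (orth_proj ip (W i) f))\<^sup>2) \<le> \<beta> * (norm f)\<^sup>2"
    using assms unfolding fusion_frame_def by blast
  then show ?thesis
    using assms order_less_le_trans[OF ab] unfolding fusion_frame_def bessel_fusion_sequence_def by blast
qed

lemma fusionI:
  assumes "separable_hilbert_space smul ip" "fusion_frame smul ip I W w"
  obtains \<alpha> \<beta> where "fusion smul ip I W w \<beta> \<alpha>"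
proof -
  obtain \<beta> where "bessel_fusion smul ip I W w \<beta>"
    using bessel_fusionI[OF assms(1) fusion_frame_imp_bessel[OF assms(2)]] .
  then show ?thesis
    using assms(2) that unfolding fusion_def fusion_axioms_def fusion_frame_def by blast
qed

lemma fusion_frame_of_lower_bound:
  assumes "bessel_fusion_sequence smul ip I V v" and "0 < c"
    and "\<And>x. c * (norm x)\<^sup>2 \<le> (\<Sum>\<^sub>\<infinity>i\<in>I. (v i)\<^sup>2 * (norm (orth_proj ip (V i) x))\<^sup>2)"
  shows "fusion_frame smul ip I V v"
proof -
  obtain \<beta> :: real where b: "0 < \<beta>" "\<And>f. (\<lambda>i. (v i)\<^sup>2 * (norm (orth_proj ip (V i) f))\<^sup>2) summable_on I \<and>
        (\<Sum>\<^sub>\<infinity>i\<in>I. (v i)\<^sup>2 * (norm (orth_proj ip (V i) f))\<^sup>2) \<le> \<beta> * (norm f)\<^sup>2"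
    using assms(1) unfolding bessel_fusion_sequence_def by blast
  \<comment> \<open>The definition of a fusion frame asks for \<open>\<alpha> \<le> \<beta>\<close>,
    which \<open>c\<close> itself can violate when the space is zero.\<close>
  have "min c \<beta> * (norm x)\<^sup>2 \<le> (\<Sum>\<^sub>\<infinity>i\<in>I. (v i)\<^sup>2 * (norm (orth_proj ip (V i) x))\<^sup>2)" for x
    by (rule order_trans[OF mult_right_mono assms(3)]) auto
  then show ?thesis
    using assms(1) b \<open>0 < c\<close> unfolding bessel_fusion_sequence_def fusion_frame_def
    by (intro conjI exI[of _ "min c \<beta>"] exI[of _ \<beta>]) auto
qed

theorem theorem3p11:
  fixes smul :: "'k::hilbert_scalar \<Rightarrow> 'h::{banach,second_countable_topology} \<Rightarrow> 'h"
    and ip :: "'h \<Rightarrow> 'h \<Rightarrow> 'k"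
    and I :: "'i set"
    and W :: "'i \<Rightarrow> 'h set"
    and w v :: "'i \<Rightarrow> real"
    and \<delta> :: real
  assumes "separable_hilbert_space smul ip"
    and "countable I"
    and "fusion_frame smul ip I W w"
    and "weights I v"
    and "\<delta> > 0"
    and "\<forall>i\<in>I. v i > \<delta>"
  shows "\<forall>V :: 'i \<Rightarrow> 'h set.
    component_preserving_dual smul ip I W w V v \<longleftrightarrow>
      bessel_fusion_sequence smul ip I V v \<and>
      (\<exists>R \<in> bounded_operators (sum_scale smul) (sum_norm I) (direct_sum I W)
                               smul norm (UNIV :: 'h set).
        \<forall>i\<in>I. V i =
          (\<lambda>f. inv (frame_operator ip I W w) (synthesis I w f)
             + R (f - analysis ip I W w (inv (frame_operator ip I W w) (synthesis I w f))))
          ` coord_proj i ` direct_sum I W)"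
proof
  fix V :: "'i \<Rightarrow> 'h set"
  obtain \<alpha> \<beta> where W: "fusion smul ip I W w \<beta> \<alpha>"
    using fusionI[OF assms(1,3)] .
  interpret W: fusion smul ip I W w \<beta> \<alpha> by (rule W)
  have pair: "\<exists>\<gamma>. fusion_pair smul ip I W w \<beta> \<alpha> V v \<gamma> \<delta>" if V: "bessel_fusion_sequence smul ip I V v"
  proof -
    obtain \<gamma> where "bessel_fusion smul ip I V v \<gamma>"
      using bessel_fusionI[OF assms(1) V] .
    with W show ?thesis
      using assms(5,6) by (auto simp: fusion_pair_def fusion_pair_axioms_def)
  qed
  show "component_preserving_dual smul ip I W w V v \<longleftrightarrow>
      bessel_fusion_sequence smul ip I V v \<and>
      (\<exists>R\<in>W.operators. \<forall>i\<in>I. V i = W.left_inverse R ` coord_proj i ` W.K)"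
  proof (intro iffI conjI)
    assume dual: "component_preserving_dual smul ip I W w V v"
    then show bessel: "bessel_fusion_sequence smul ip I V v"
      by (auto simp: component_preserving_dual_def intro: fusion_frame_imp_bessel)
    then obtain \<gamma> where "fusion_pair smul ip I W w \<beta> \<alpha> V v \<gamma> \<delta>" using pair by blast
    then interpret fusion_pair smul ip I W w \<beta> \<alpha> V v \<gamma> \<delta> .
    from dual obtain Q where Q: "Q \<in> operators_WV" and Q_dual: "\<forall>x. synthesis I v (Q (W.Tadj x)) = x"
      and Q_image: "\<forall>i\<in>I. Q ` coord_proj i ` W.K = coord_proj i ` V.K"
      unfolding component_preserving_dual_def by (elim conjE bexE)
    \<comment> \<open>By \<open>Q_dual\<close> this is a left inverse of \<open>W.Tadj\<close>,
      hence reproduced by \<open>W.left_inverse\<close> on \<open>W.K\<close>, and it can serve as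
      the parameter.\<close>
    let ?R = "\<lambda>f. synthesis I v (Q f)"
    note R = synthesis_comp_operator[OF Q]
    have "V i = W.left_inverse ?R ` coord_proj i ` W.K" if i: "i \<in> I" for i
    proof -
      have "W.left_inverse ?R ` coord_proj i ` W.K = ?R ` coord_proj i ` W.K"
      proof (intro image_cong refl)
        fix f assume "f \<in> coord_proj i ` W.K"
        then have "f \<in> W.K" using W.K_coord_proj by blast
        then show "W.left_inverse ?R f = ?R f"
          by (rule W.left_inverse_fixed[OF R Q_dual[rule_format]])
      qed
      also have "\<dots> = synthesis I v ` coord_proj i ` V.K"
        unfolding Q_image[rule_format, OF i, symmetric] image_image ..
      \<comment> \<open>On a family supported at \<open>i\<close>, synthesis is multiplication of
        that component by \<open>v i\<close>.\<close>
      also have "\<dots> = (\<lambda>f. v i *\<^sub>R f i) ` coord_proj i ` V.K"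
        using i by (simp add: image_image V.synthesis_coord_proj) (simp add: coord_proj_def)
      also have "\<dots> = V i"
        using i delta_less[OF i] delta_pos by (intro V.image_coord_proj_scaled) auto
      finally show ?thesis by simp
    qed
    then show "\<exists>R\<in>W.operators. \<forall>i\<in>I. V i = W.left_inverse R ` coord_proj i ` W.K"
      by (intro bexI[OF _ R] ballI)
  next
    assume "bessel_fusion_sequence smul ip I V v \<and>
      (\<exists>R\<in>W.operators. \<forall>i\<in>I. V i = W.left_inverse R ` coord_proj i ` W.K)"
    then obtain R where bessel: "bessel_fusion_sequence smul ip I V v" and R: "R \<in> W.operators"
      and "\<forall>i\<in>I. V i = W.left_inverse R ` coord_proj i ` W.K"
      by (elim conjE bexE)
    then have V: "V i = W.left_inverse R ` coord_proj i ` W.K" if "i \<in> I" for i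
      using that by (elim bspec)
    obtain \<gamma> where "fusion_pair smul ip I W w \<beta> \<alpha> V v \<gamma> \<delta>" using pair[OF bessel] by blast
    then interpret fusion_pair smul ip I W w \<beta> \<alpha> V v \<gamma> \<delta> .
    let ?Q = "rescaled_components I v (W.left_inverse R)"
    note A = W.left_inverse_operator[OF R]
    have Q: "?Q \<in> operators_WV"
      by (rule rescaled_operator[OF A V])
    have dual: "synthesis I v (?Q (W.Tadj x)) = x" for x
      using synthesis_rescaled[OF A V W.analysis_in] W.left_inverse_analysis[OF R] by simp
    \<comment> \<open>The identity \<open>dual\<close> now supplies the lower bound, which upgrades
      the Bessel sequence to a fusion frame.\<close>
    obtain c where "0 < c" "\<And>x. c * (norm x)\<^sup>2 \<le> V.energy x"
      using lower_bound_of_dual[OF Q dual] by (elim exE conjE) (rule that, assumption, erule spec)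
    then have "fusion_frame smul ip I V v"
      by (rule fusion_frame_of_lower_bound[OF bessel])
    then show "component_preserving_dual smul ip I W w V v"
      unfolding component_preserving_dual_def
      using assms(3) by (intro conjI bexI[OF _ Q] allI ballI dual rescaled_image[OF A V])
  qed
qed

end
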